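(* Let $0 < \epsilon < 1$, let $k \ge 1$ be an integer, and let $A \subset \mathbb{Z}\setminus\{0\}$ be a finite non-empty set. Then $$\lambda_k(A) \leq 10\, \beta_*(A)^{\frac{1}{\epsilon}}\, |A|^{2\epsilon \log_2 k},$$ where $$\beta_*(A) := \inf_{B, C} \frac{|ABC|}{|B|^{1/2}|C|^{1/2}},$$ the infimum being over all finite non-empty sets $B, C \subset \mathbb{Z}\setminus\{0\}$.
   Context: $ABC = \{abc : a \in A, b \in B, c \in C\}$, and $|X|$ denotes the cardinality of $X$. For a finite set $A$ of integers, $$\lambda_k(A) := \max \left\| \sum_{n \in A} c_n e^{2\pi i n x} \right\|^2_{L_{2k}([0,1])},$$ where the norm is taken with respect to $x$ and the maximum (supremum) is taken over positive weights $\{c_n\}_{n \in A}$ with $\sum_{n \in A} c_n^2 = 1$. *)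

theory Defs
  imports "HOL-Analysis.Analysis" "HOL-Library.Set_Algebras"
begin

definition Lp_norm01 :: "real \<Rightarrow> (real \<Rightarrow> complex) \<Rightarrow> real" where
  "Lp_norm01 p f = (LBINT x:{0..1}. norm (f x) powr p) powr (1 / p)"

definition trig_poly :: "int set \<Rightarrow> (int \<Rightarrow> real) \<Rightarrow> real \<Rightarrow> complex" where
  "trig_poly A c x =
     (\<Sum>n\<in>A. complex_of_real (c n) * exp (2 * complex_of_real pi * \<i> * of_int n * complex_of_real x))"

text \<open>
  The weights are total functions on the integers, but only their values on \<open>A\<close> matter.
  They are strictly positive, so the extremal value need not be attained;
  it is therefore a supremum. For finite nonempty \<open>A\<close> the set of values
  is nonempty and bounded above by the cardinality of \<open>A\<close>.
\<close>
definition lam :: "nat \<Rightarrow> int set \<Rightarrow> real" where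
  "lam k A =
     (SUP c \<in> {c. (\<forall>n\<in>A. 0 < c n) \<and> (\<Sum>n\<in>A. (c n)\<^sup>2) = 1}.
        (Lp_norm01 (2 * real k) (trig_poly A c))\<^sup>2)"

text \<open>
  The product \<open>A * B * C\<close> of sets is the elementwise one of \<open>Set_Algebras\<close>,
  that is, \<open>{a * b * c | a b c. a \<in> A \<and> b \<in> B \<and> c \<in> C}\<close>.
\<close>
definition beta_star :: "int set \<Rightarrow> real" where
  "beta_star A =
     (INF (B, C) \<in> {(B, C). finite B \<and> B \<noteq> {} \<and> 0 \<notin> B \<and> finite C \<and> C \<noteq> {} \<and> 0 \<notin> C}.
        real (card (A * B * C)) / (real (card B) powr (1/2) * real (card C) powr (1/2)))"

end

theory Submission
  imports Defs
begin

text \<open>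
  Write \<open>\<beta>\<close> for \<^term>\<open>beta_star A\<close>, and call the elements of \<open>A\<close> with a given \<open>p\<close>-adic valuation a fibre.
  Two facts about fibres, one analytic and one combinatorial, are played against each other.

  Analytic: if each fibre of \<open>A\<close> at a prime \<open>p\<close> satisfies the wanted inequality with constant \<open>L\<close>, then \<open>A\<close>
  satisfies it with constant \<open>k\<^sup>2 L\<close>, however many fibres there are (\<open>moment_bound_fibres\<close>). A trigonometric
  polynomial with frequencies divisible by a power of \<open>p\<close> and one with frequencies not divisible by it are
  orthogonal in a strong enough sense that \<open>\<parallel>f + g\<parallel>\<^sup>2 \<le> \<parallel>f\<parallel>\<^sup>2 + k\<^sup>2 \<parallel>g\<parallel>\<^sup>2\<close> in \<open>L\<^sup>2\<^sup>k\<close> (\<open>moment_Un_le_of_dvd\<close>).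

  Combinatorial: the constants of two different non-empty fibres add up to at most \<open>\<beta>\<close>
  (\<open>beta_star_add_fibres\<close>). This tensorisation property comes from a weighted discrete Prekopa-Leindler
  inequality applied to the sizes of the fibres of \<open>B\<close>, \<open>C\<close> and \<open>A * B * C\<close> (\<open>weighted_Prekopa_Leindler\<close>).

  Consequently all fibres except the one with the largest constant have constant at most \<open>\<beta> / 2\<close>. In the tree
  obtained by splitting at one prime after another, a step away from the largest fibre can thus occur
  only \<open>log\<^sub>2 \<beta>\<close> times, and only such steps have to pay the factor \<open>k\<^sup>2\<close>. Keeping at each
  node either the largest fibre or all the others, whichever is better, produces for every weight on \<open>A\<close> a subset that
  has at least the share \<open>1 / (2 \<beta>)\<close> of the weight and constant at most \<open>k\<close> to the power \<open>2 log\<^sub>2 \<beta>\<close>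
  (\<open>exists_large_moment_bounded_subset\<close>).

  Since this works for every weight, a bootstrap with the triangle inequality turns it into a
  bound for the whole of \<open>A\<close>, losing only the factor \<open>4 * 2 \<beta>\<close> (\<open>moment_bound_bootstrap\<close>). Thus
  \<^term>\<open>lam k A\<close> is at most \<open>8 \<beta>\<close> times \<open>k\<close> to the power \<open>2 log\<^sub>2 \<beta>\<close>. If \<open>\<beta> \<le> |A|\<^sup>\<epsilon>\<close>, this is the claim. Otherwise
  \<open>\<beta> powr (1 / \<epsilon>)\<close> exceeds \<open>|A|\<close>, which is a trivial bound for \<open>lam k A\<close>.
\<close>

section \<open>A pointwise inequality with a linear term\<close>

lemma one_plus_power_le_quadratic:
  fixes t :: real
  assumes "0 \<le> t" "real n * t \<le> 1 + t"
  shows "(1 + t) ^ n \<le> 1 + real n * t + (real n * t)\<^sup>2"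
  using assms(2)
proof (induction n)
  case (Suc n)
  have nt: "real n * t \<le> 1"
    using Suc.prems by (simp add: algebra_simps)
  then have IH: "(1 + t) ^ n \<le> 1 + real n * t + (real n * t)\<^sup>2"
    using Suc.IH assms(1) by linarith
  have "(1 + t) ^ Suc n \<le> (1 + t) * (1 + real n * t + (real n * t)\<^sup>2)"
    using IH assms(1) by (simp add: mult_left_mono)
  also have "\<dots> = 1 + (real n + 1) * t + (real n ^ 2 + real n) * t\<^sup>2 + (real n * t) * (real n * t\<^sup>2)"
    by (simp add: algebra_simps power2_eq_square)
  also have "\<dots> \<le> 1 + (real n + 1) * t + (real n ^ 2 + real n) * t\<^sup>2 + 1 * (real n * t\<^sup>2)"
    by (intro add_left_mono mult_right_mono nt) auto
  also have "\<dots> \<le> 1 + real (Suc n) * t + (real (Suc n) * t)\<^sup>2"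
    by (simp add: algebra_simps power2_eq_square)
  finally show ?case .
qed simp

text \<open>
  Where \<open>(1 + t)\<^sup>2 \<le> 1 + (k t)\<^sup>2\<close> there is nothing to do, and this holds as soon as
  \<open>t \<ge> 2 / (k\<^sup>2 - 1)\<close>. For smaller \<open>t\<close> and \<open>k \<ge> 4\<close> the quantity \<open>(2 k - 1) t\<close> is at most 1, so the
  left side without its linear term is at most \<open>1 + 4 k\<^sup>2 t\<^sup>2 \<le> 1 + k\<^sup>3 t\<^sup>2\<close>, which Bernoulli's
  inequality bounds by the right side. For \<open>k \<le> 3\<close> the difference of the
  two sides is a polynomial that is visibly non-negative.
  The factor \<open>k\<^sup>2\<close> in front of \<open>t\<^sup>2\<close> is what becomes \<open>|A|\<close> to the power
  \<open>2 \<epsilon> log\<^sub>2 k\<close> at the end.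
\<close>
lemma one_plus_power_minus_linear_le:
  fixes t :: real
  assumes "0 \<le> t" "k \<ge> 1"
  shows "(1 + t) ^ (2 * k) - 2 * real k * t \<le> (1 + (real k * t)\<^sup>2) ^ k"
proof -
  consider "k = 1" | "k = 2" | "k = 3" | "k \<ge> 4" using assms(2) by linarith
  then show ?thesis
  proof cases
    case 1
    then show ?thesis by (simp add: power2_eq_square algebra_simps)
  next
    case 2
    have "(1 + (2 * t)\<^sup>2) ^ 2 - ((1 + t) ^ 4 - 4 * t) = 2 * (t * (1 - t))\<^sup>2 + 13 * (t\<^sup>2)\<^sup>2"
      by algebra
    also have "\<dots> \<ge> 0" by simp
    finally show ?thesis using 2 by simp
  next
    case 3
    have "(1 + (3 * t)\<^sup>2) ^ 3 - ((1 + t) ^ 6 - 6 * t)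
        = 12 * (t * (1 - t))\<^sup>2 + 3 * (t\<^sup>2 * (1 - t))\<^sup>2 + 4 * t ^ 3 + 213 * (t\<^sup>2)\<^sup>2 + 725 * (t ^ 3)\<^sup>2"
      by algebra
    also have "\<dots> \<ge> 0" using assms(1) by simp
    finally show ?thesis using 3 by simp
  next
    case 4
    define K where "K = real k"
    have K: "K \<ge> 4" using 4 by (simp add: K_def)
    show ?thesis
    proof (cases "2 \<le> (K\<^sup>2 - 1) * t")
      case True
      have "2 * t \<le> (K\<^sup>2 - 1) * t * t"
        using True assms(1) by (simp add: mult_right_mono)
      then have "(1 + t)\<^sup>2 \<le> 1 + (K * t)\<^sup>2"
        by (simp add: power2_eq_square algebra_simps)
      then have "((1 + t)\<^sup>2) ^ k \<le> (1 + (K * t)\<^sup>2) ^ k"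
        by (intro power_mono) auto
      then have "(1 + t) ^ (2 * k) \<le> (1 + (K * t)\<^sup>2) ^ k" by (simp add: power_mult)
      moreover have "0 \<le> 2 * K * t" using K assms(1) by simp
      ultimately show ?thesis unfolding K_def by linarith
    next
      case False
      have "4 * K \<le> K * K" using K by (intro mult_right_mono) auto
      then have "(2 * K - 1) * 2 \<le> K\<^sup>2 - 1" by (simp add: power2_eq_square)
      then have "(2 * K - 1) * 2 * t \<le> (K\<^sup>2 - 1) * t"
        using assms(1) by (intro mult_right_mono)
      then have "(2 * K - 1) * t \<le> 1" using False by linarith
      then have "(1 + t) ^ (2 * k) \<le> 1 + real (2 * k) * t + (real (2 * k) * t)\<^sup>2"
        using assms(1) by (intro one_plus_power_le_quadratic) (auto simp: K_def algebra_simps)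
      moreover have "(real (2 * k) * t)\<^sup>2 \<le> real k * (K * t)\<^sup>2"
        using K mult_right_mono[of 4 K "K\<^sup>2 * t\<^sup>2"] by (simp add: K_def power_mult_distrib)
      moreover have "1 + real k * (K * t)\<^sup>2 \<le> (1 + (K * t)\<^sup>2) ^ k"
        by (rule Bernoulli_inequality) (smt (verit) zero_le_power2)
      ultimately show ?thesis by (simp add: K_def)
    qed
  qed
qed

lemma power_add_minus_linear_le:
  fixes a b :: real
  assumes "0 \<le> a" "0 \<le> b" "k \<ge> 1"
  shows "(a + b) ^ (2 * k) - 2 * real k * a ^ (2 * k - 1) * b \<le> (a\<^sup>2 + (real k * b)\<^sup>2) ^ k"
proof (cases "a = 0")
  case True
  have "b ^ (2 * k) \<le> (real k * b) ^ (2 * k)"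
    using assms by (intro power_mono) (auto simp: mult_le_cancel_right1)
  then show ?thesis using True assms by (simp add: power_mult power_0_left)
next
  case False
  define t where "t = b / a"
  have b: "b = a * t" and t: "0 \<le> t" using False assms by (auto simp: t_def)
  have a: "a ^ (2 * k - 1) * a = a ^ (2 * k)"
    using assms(3) by (metis mult.commute power_eq_if mult_eq_0_iff not_one_le_zero zero_neq_numeral)
  have "(a + b) ^ (2 * k) - 2 * real k * a ^ (2 * k - 1) * b
      = (a * (1 + t)) ^ (2 * k) - 2 * real k * t * (a ^ (2 * k - 1) * a)"
    by (simp add: b distrib_left mult_ac)
  also have "\<dots> = a ^ (2 * k) * ((1 + t) ^ (2 * k) - 2 * real k * t)"
    unfolding a power_mult_distrib by (simp add: right_diff_distrib mult_ac)
  also have "\<dots> \<le> a ^ (2 * k) * (1 + (real k * t)\<^sup>2) ^ k"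
    using assms t by (intro mult_left_mono one_plus_power_minus_linear_le) auto
  also have "\<dots> = (a\<^sup>2 * (1 + (real k * t)\<^sup>2)) ^ k"
    by (simp add: power_mult_distrib power_mult)
  also have "a\<^sup>2 * (1 + (real k * t)\<^sup>2) = a\<^sup>2 + (real k * b)\<^sup>2"
    by (simp add: b algebra_simps power_mult_distrib)
  finally show ?thesis .
qed

text \<open>
  The binomial terms of order at least two in \<open>w\<close> are estimated one by one by their moduli.
  The recursion \<open>R (n + 1) = (z + w) R n + n z\<^sup>n\<^sup>-\<^sup>1 w\<^sup>2\<close> for the remainder does this without binomial
  coefficients.
\<close>
lemma norm_power_add_remainder_le:
  fixes z w :: complex
  shows "norm ((z + w) ^ n - z ^ n - of_nat n * z ^ (n - 1) * w)
    \<le> (norm z + norm w) ^ n - norm z ^ n - real n * norm z ^ (n - 1) * norm w"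
proof (induction n)
  case (Suc n)
  define R where "R = (z + w) ^ n - z ^ n - of_nat n * z ^ (n - 1) * w"
  define r where "r = (norm z + norm w) ^ n - norm z ^ n - real n * norm z ^ (n - 1) * norm w"
  have z: "of_nat n * z ^ n = of_nat n * z ^ (n - 1) * z" by (cases n) auto
  have nz: "real n * norm z ^ n = real n * norm z ^ (n - 1) * norm z" by (cases n) auto
  have "(z + w) ^ Suc n - z ^ Suc n - of_nat (Suc n) * z ^ (Suc n - 1) * w
      = (z + w) * R + of_nat n * z ^ (n - 1) * w\<^sup>2"
    using z by (simp add: R_def ring_distribs mult_ac power2_eq_square)
  also have "norm \<dots> \<le> (norm z + norm w) * r + real n * norm z ^ (n - 1) * (norm w)\<^sup>2"
    using Suc.IH unfolding R_def[symmetric] r_def[symmetric]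
    by (intro order_trans[OF norm_triangle_ineq] add_mono)
      (auto simp: norm_mult norm_power intro!: mult_mono norm_triangle_ineq)
  also have "\<dots> = (norm z + norm w) ^ Suc n - norm z ^ Suc n - real (Suc n) * norm z ^ (Suc n - 1) * norm w"
    using nz by (simp add: r_def ring_distribs mult_ac power2_eq_square) auto
  finally show ?case .
qed simp

text \<open>
  Expanding \<open>|z + w|\<^sup>2\<^sup>k = (z + w)\<^sup>k cnj (z + w)\<^sup>k\<close> and bounding every term except those of order
  at most one in \<open>w\<close> by its modulus leaves the quantity estimated in
  \<open>power_add_minus_linear_le\<close>. The linear term is kept exactly because it integrates to zero when the frequencies
  of \<open>z\<close> and \<open>w\<close> are separated by divisibility.
\<close>
lemma norm_add_power_le:
  fixes z w :: complex
  assumes "k \<ge> 1"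
  shows "norm (z + w) ^ (2 * k)
    \<le> 2 * real k * Re (z ^ (k - 1) * cnj z ^ k * w) + ((norm z)\<^sup>2 + (real k * norm w)\<^sup>2) ^ k"
proof -
  define a b where "a = norm z" and "b = norm w"
  define L where "L = of_nat k * z ^ (k - 1) * w"
  define R where "R = (z + w) ^ k - z ^ k - L"
  define r where "r = (a + b) ^ k - a ^ k - real k * a ^ (k - 1) * b"
  have R: "norm R \<le> r"
    using norm_power_add_remainder_le[of z w k] by (simp add: R_def L_def r_def a_def b_def)
  have sq: "(norm (x + y))\<^sup>2 = (norm x)\<^sup>2 + 2 * Re (cnj x * y) + (norm y)\<^sup>2" for x y :: complex
    unfolding cmod_power2 by (simp add: power2_eq_square algebra_simps)
  have L: "norm L = real k * a ^ (k - 1) * b"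
    by (simp add: L_def norm_mult norm_power a_def b_def)
  have "norm (z + w) ^ (2 * k) = (norm ((z + w) ^ k))\<^sup>2"
    by (simp add: norm_power power_mult mult.commute)
  also have "(z + w) ^ k = z ^ k + (L + R)" by (simp add: R_def)
  also have "(norm \<dots>)\<^sup>2 = (norm (z ^ k))\<^sup>2 + 2 * Re (cnj (z ^ k) * L)
      + 2 * Re (cnj (z ^ k) * R) + (norm (L + R))\<^sup>2"
    unfolding sq by (simp add: algebra_simps)
  \<comment> \<open>Only the cross term with \<open>R\<close> is estimated by its modulus; the one with \<open>L\<close> is kept.\<close>
  also have "\<dots> \<le> (a ^ k)\<^sup>2 + 2 * Re (cnj (z ^ k) * L)
      + 2 * (a ^ k * r) + (real k * a ^ (k - 1) * b + r)\<^sup>2"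
  proof (intro add_mono power_mono mult_left_mono order_refl)
    have "Re (cnj (z ^ k) * R) \<le> norm (cnj (z ^ k) * R)" by (rule complex_Re_le_cmod)
    also have "\<dots> \<le> a ^ k * r"
      using R by (simp add: norm_mult norm_power a_def mult_left_mono)
    finally show "Re (cnj (z ^ k) * R) \<le> a ^ k * r" .
    show "norm (L + R) \<le> real k * a ^ (k - 1) * b + r"
      using norm_triangle_ineq[of L R] L R by linarith
  qed (auto simp: norm_power a_def)
  also have "\<dots> = 2 * Re (cnj (z ^ k) * L) + ((a + b) ^ k)\<^sup>2 - 2 * (a ^ k * (real k * a ^ (k - 1) * b))"
    by (simp add: r_def power2_eq_square algebra_simps)
  also have "((a + b) ^ k)\<^sup>2 = (a + b) ^ (2 * k)" by (simp add: power_mult mult.commute)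
  also have "a ^ k * (real k * a ^ (k - 1) * b) = real k * a ^ (2 * k - 1) * b"
  proof -
    have "2 * k - 1 = k + (k - 1)" using assms by simp
    then show ?thesis by (simp only: power_add) (simp add: algebra_simps)
  qed
  also have "Re (cnj (z ^ k) * L) = real k * Re (z ^ (k - 1) * cnj z ^ k * w)"
  proof -
    have "cnj (z ^ k) * L = of_real (real k) * (z ^ (k - 1) * cnj z ^ k * w)"
      by (simp add: L_def algebra_simps)
    then show ?thesis by (simp only: times_complex.sel) simp
  qed
  finally show ?thesis
    using power_add_minus_linear_le[of a b k] assms by (simp add: a_def b_def)
qed

section \<open>Moments of trigonometric polynomials\<close>

lemma convex_on_power_nonneg: "convex_on {0..} (\<lambda>x::real. x ^ n)"
  by (cases "even n")
    (auto intro: convex_power_odd convex_on_subset[OF convex_power_even])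

text \<open>
  This is Minkowski's inequality in \<open>L\<^sup>n\<close> of the unit interval. It follows from convexity of
  \<open>x \<mapsto> x\<^sup>n\<close>, applied to \<open>u / U\<close> and \<open>v / V\<close> with weights proportional to \<open>U\<close> and \<open>V\<close>.
\<close>
lemma integral_power_add_le:
  fixes u v :: "real \<Rightarrow> real"
  assumes cont: "continuous_on {0..1} u" "continuous_on {0..1} v"
    and nonneg: "\<And>x. 0 \<le> u x" "\<And>x. 0 \<le> v x"
    and UV: "0 \<le> U" "0 \<le> V"
    and bd: "integral {0..1} (\<lambda>x. u x ^ n) \<le> U ^ n" "integral {0..1} (\<lambda>x. v x ^ n) \<le> V ^ n"
  shows "integral {0..1} (\<lambda>x. (u x + v x) ^ n) \<le> (U + V) ^ n"
proof -
  have pos: "integral {0..1} (\<lambda>x. (u x + v x) ^ n) \<le> (U + V) ^ n"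
    if UV: "0 < U" "0 < V"
      and bd: "integral {0..1} (\<lambda>x. u x ^ n) \<le> U ^ n" "integral {0..1} (\<lambda>x. v x ^ n) \<le> V ^ n"
    for U V
  proof -
    define \<theta> where "\<theta> = U / (U + V)"
    have \<theta>: "0 \<le> \<theta>" "0 \<le> 1 - \<theta>" using UV by (auto simp: \<theta>_def)
    have \<theta>': "1 - \<theta> = V / (U + V)" using UV by (simp add: \<theta>_def field_simps)
    have pt: "(u x + v x) ^ n \<le> (U + V) ^ n * (\<theta> * (u x ^ n / U ^ n) + (1 - \<theta>) * (v x ^ n / V ^ n))" for x
    proof -
      have "u x + v x = (U + V) * (\<theta> * (u x / U) + (1 - \<theta>) * (v x / V))"
        unfolding \<theta>' using UV by (simp add: \<theta>_def distrib_left)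
      moreover have "(\<theta> * (u x / U) + (1 - \<theta>) * (v x / V)) ^ n
          \<le> \<theta> * (u x / U) ^ n + (1 - \<theta>) * (v x / V) ^ n"
        using convex_onD[OF convex_on_power_nonneg[of n], of "1 - \<theta>" "u x / U" "v x / V"] \<theta> nonneg UV
        by simp
      ultimately show ?thesis
        using UV by (simp add: power_mult_distrib power_divide mult_left_mono)
    qed
    have "integral {0..1} (\<lambda>x. (u x + v x) ^ n)
        \<le> integral {0..1} (\<lambda>x. (U + V) ^ n * (\<theta> * (u x ^ n / U ^ n) + (1 - \<theta>) * (v x ^ n / V ^ n)))"
      by (intro integral_le pt integrable_continuous_real continuous_intros cont) (use UV in auto)
    also have "\<dots> = (U + V) ^ n * (\<theta> * (integral {0..1} (\<lambda>x. u x ^ n) / U ^ n)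
        + (1 - \<theta>) * (integral {0..1} (\<lambda>x. v x ^ n) / V ^ n))"
      using UV by (subst integral_mult_right, subst integral_add)
        (auto intro!: integrable_continuous_real continuous_intros cont)
    also have "\<dots> \<le> (U + V) ^ n * (\<theta> * 1 + (1 - \<theta>) * 1)"
      using UV bd \<theta> by (intro mult_left_mono add_mono) auto
    finally show ?thesis by simp
  qed
  \<comment> \<open>The weights above need positive norms, so both bounds are first enlarged by \<open>e > 0\<close>.\<close>
  have "\<forall>\<^sub>F e in at_right (0::real). integral {0..1} (\<lambda>x. (u x + v x) ^ n) \<le> ((U + e) + (V + e)) ^ n"
    unfolding eventually_at_right_field
  proof (intro exI[of _ 1] conjI allI impI)
    fix e :: real assume e: "e > 0"
    have "U ^ n \<le> (U + e) ^ n" "V ^ n \<le> (V + e) ^ n"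
      using UV e by (auto intro: power_mono)
    then show "integral {0..1} (\<lambda>x. (u x + v x) ^ n) \<le> ((U + e) + (V + e)) ^ n"
      using UV e bd by (intro pos) auto
  qed auto
  moreover have "((\<lambda>e. ((U + e) + (V + e)) ^ n) \<longlongrightarrow> ((U + 0) + (V + 0)) ^ n) (at_right (0::real))"
    by (intro tendsto_intros)
  ultimately show ?thesis
    by (intro tendsto_lowerbound[where F = "at_right (0::real)"]) auto
qed

definition character :: "int \<Rightarrow> real \<Rightarrow> complex" where
  "character n x = exp (2 * complex_of_real pi * \<i> * of_int n * complex_of_real x)"

lemma trig_poly_character: "trig_poly A c x = (\<Sum>n\<in>A. of_real (c n) * character n x)"
  by (simp add: trig_poly_def character_def)

lemma character_add: "character (m + n) x = character m x * character n x"
  by (simp add: character_def exp_add[symmetric] algebra_simps)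

lemma cnj_character: "cnj (character n x) = character (- n) x"
  by (simp add: character_def exp_cnj)

lemma norm_character [simp]: "norm (character n x) = 1"
  by (simp add: character_def norm_exp_eq_Re)

lemma continuous_on_character [continuous_intros]: "continuous_on S (character n)"
  unfolding character_def by (intro continuous_intros)

lemma continuous_on_trig_poly [continuous_intros]: "continuous_on S (trig_poly A c)"
  unfolding trig_poly_def by (intro continuous_intros)

lemma integral_character_eq_0:
  assumes "n \<noteq> 0"
  shows "integral {0..1} (character n) = 0"
proof -
  define w where "w = 2 * complex_of_real pi * \<i> * of_int n"
  have w: "w \<noteq> 0" using assms by (simp add: w_def)
  have "((\<lambda>x. exp (w * of_real x) / w) has_vector_derivative character n x) (at x within {0..1})" for x
    unfolding character_def w_def[symmetric]
    using w by (auto intro!: derivative_eq_intros has_vector_derivative_real_field)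
  then have "(character n has_integral (exp (w * of_real 1) / w - exp (w * of_real 0) / w)) {0..1}"
    by (intro fundamental_theorem_of_calculus) auto
  moreover have "exp w = 1"
    using exp_integer_2pi[of "of_int n"] by (simp add: w_def mult_ac)
  ultimately show ?thesis by (simp add: integral_unique)
qed

text \<open>
  Continuous functions whose Fourier coefficients vanish off the multiples of \<open>P\<close>. This form is
  preserved under multiplication by characters of frequency divisible by \<open>P\<close>, which makes
  the inductions below immediate.
\<close>
definition orthogonal_off_multiples :: "int \<Rightarrow> (real \<Rightarrow> complex) \<Rightarrow> bool" where
  "orthogonal_off_multiples P g \<longleftrightarrow> continuous_on {0..1} g \<and>
     (\<forall>n. \<not> P dvd n \<longrightarrow> integral {0..1} (\<lambda>x. g x * character n x) = 0)"

lemma orthogonal_off_multiples_sum: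
  assumes "orthogonal_off_multiples P g" "\<And>a. a \<in> A \<Longrightarrow> P dvd \<sigma> a"
  shows "orthogonal_off_multiples P (\<lambda>x. g x * (\<Sum>a\<in>A. d a * character (\<sigma> a) x))"
  unfolding orthogonal_off_multiples_def
proof (intro conjI allI impI)
  have g: "continuous_on {0..1} g" using assms(1) by (simp add: orthogonal_off_multiples_def)
  then show "continuous_on {0..1} (\<lambda>x. g x * (\<Sum>a\<in>A. d a * character (\<sigma> a) x))"
    by (intro continuous_intros)
  fix n assume n: "\<not> P dvd n"
  have "integral {0..1} (\<lambda>x. g x * (\<Sum>a\<in>A. d a * character (\<sigma> a) x) * character n x)
      = integral {0..1} (\<lambda>x. \<Sum>a\<in>A. d a * (g x * character (\<sigma> a + n) x))"
    by (intro integral_cong) (simp add: character_add sum_distrib_left sum_distrib_right mult_ac)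
  also have "\<dots> = (\<Sum>a\<in>A. d a * integral {0..1} (\<lambda>x. g x * character (\<sigma> a + n) x))"
  proof (cases "finite A")
    case True
    then show ?thesis
      by (subst integral_sum) (auto intro!: integrable_continuous_real continuous_intros g)
  qed simp
  also have "\<dots> = 0"
    using assms n by (intro sum.neutral) (auto simp: orthogonal_off_multiples_def dvd_add_right_iff)
  finally show "integral {0..1} (\<lambda>x. g x * (\<Sum>a\<in>A. d a * character (\<sigma> a) x) * character n x) = 0" .
qed

lemma orthogonal_off_multiples_trig_poly_powers:
  assumes "\<And>a. a \<in> A \<Longrightarrow> P dvd a"
  shows "orthogonal_off_multiples P (\<lambda>x. trig_poly A c x ^ i * cnj (trig_poly A c x) ^ j)"
proof (induction j)
  case 0
  show ?case
  proof (induction i)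
    case 0
    show ?case
      unfolding orthogonal_off_multiples_def
      by (auto intro!: integral_character_eq_0)
  next
    case (Suc i)
    from orthogonal_off_multiples_sum[OF this, of A "\<lambda>a. a" "\<lambda>a. of_real (c a)"] assms
    show ?case by (simp add: trig_poly_character mult_ac)
  qed
next
  case (Suc j)
  from orthogonal_off_multiples_sum[OF this, of A "\<lambda>a. - a" "\<lambda>a. of_real (c a)"] assms
  show ?case by (simp add: trig_poly_character mult_ac cnj_character)
qed

definition moment :: "nat \<Rightarrow> int set \<Rightarrow> (int \<Rightarrow> real) \<Rightarrow> real" where
  "moment k A c = integral {0..1} (\<lambda>x. norm (trig_poly A c x) ^ (2 * k))"

lemma trig_poly_Un:
  assumes "finite A" "finite B" "A \<inter> B = {}"
  shows "trig_poly (A \<union> B) c x = trig_poly A c x + trig_poly B c x"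
  using assms by (simp add: trig_poly_def sum.union_disjoint)

text \<open>
  If \<open>f\<close> has frequencies divisible by \<open>P\<close> and \<open>g\<close> has none, then the linear term
  \<open>Re (f\<^sup>k\<^sup>-\<^sup>1 cnj f\<^sup>k g)\<close> of the pointwise inequality has integral zero. What remains is the \<open>k\<close>-th
  power of \<open>|f|\<^sup>2 + k\<^sup>2 |g|\<^sup>2\<close>, and Minkowski's inequality in \<open>L\<^sup>k\<close> gives
  \<open>\<parallel>f + g\<parallel>\<^sup>2 \<le> \<parallel>f\<parallel>\<^sup>2 + k\<^sup>2 \<parallel>g\<parallel>\<^sup>2\<close> for the norm of \<open>L\<^sup>2\<^sup>k\<close>. That \<open>f\<close> enters with factor 1 is essential: it lets
  one peel off one valuation class after another at the total cost of a single factor \<open>k\<^sup>2\<close>.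
\<close>
lemma moment_Un_le_of_dvd:
  assumes "finite A" "finite B" "k \<ge> 1"
    and A: "\<And>a. a \<in> A \<Longrightarrow> P dvd a" and B: "\<And>b. b \<in> B \<Longrightarrow> \<not> P dvd b"
    and UV: "0 \<le> U" "0 \<le> V" "moment k A c \<le> U ^ k" "moment k B c \<le> V ^ k"
  shows "moment k (A \<union> B) c \<le> (U + (real k)\<^sup>2 * V) ^ k"
proof -
  define f g where "f = trig_poly A c" and "g = trig_poly B c"
  define h where "h = (\<lambda>x. f x ^ (k - 1) * cnj (f x) ^ k)"
  have contf [continuous_intros]: "continuous_on S f" and contg [continuous_intros]: "continuous_on S g"
    for S by (auto simp: f_def g_def intro: continuous_intros)
  have h: "orthogonal_off_multiples P h"
    unfolding h_def f_def by (rule orthogonal_off_multiples_trig_poly_powers[OF A])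
  then have conth [continuous_intros]: "continuous_on {0..1} h"
    by (simp add: orthogonal_off_multiples_def)
  have hg: "integral {0..1} (\<lambda>x. h x * g x) = 0"
  proof -
    have "integral {0..1} (\<lambda>x. h x * g x)
        = integral {0..1} (\<lambda>x. \<Sum>n\<in>B. of_real (c n) * (h x * character n x))"
      by (simp add: g_def trig_poly_character sum_distrib_left mult_ac)
    also have "\<dots> = (\<Sum>n\<in>B. of_real (c n) * integral {0..1} (\<lambda>x. h x * character n x))"
      using assms(2) by (subst integral_sum) (auto intro!: integrable_continuous_real continuous_intros)
    also have "\<dots> = 0"
      using h B by (auto simp: orthogonal_off_multiples_def)
    finally show ?thesis .
  qed
  have Re0: "integral {0..1} (\<lambda>x. Re (h x * g x)) = 0"
    using integral_linear[OF _ bounded_linear_Re, of "\<lambda>x. h x * g x" "{0..1}"] hg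
    by (simp add: o_def integrable_continuous_real continuous_intros contg conth del: times_complex.sel)
  have "A \<inter> B = {}" using A B by blast
  then have "moment k (A \<union> B) c = integral {0..1} (\<lambda>x. norm (f x + g x) ^ (2 * k))"
    using assms(1,2) by (simp add: moment_def trig_poly_Un f_def g_def)
  also have "\<dots> \<le> integral {0..1} (\<lambda>x. 2 * real k * Re (h x * g x)
      + ((norm (f x))\<^sup>2 + (real k * norm (g x))\<^sup>2) ^ k)"
    by (intro integral_le integrable_continuous_real continuous_intros)
      (use norm_add_power_le[OF assms(3)] in \<open>auto simp: h_def\<close>)
  also have "\<dots> = integral {0..1} (\<lambda>x. ((norm (f x))\<^sup>2 + (real k * norm (g x))\<^sup>2) ^ k)"
    by (subst integral_add)
      (auto intro!: integrable_continuous_real continuous_intros simp: Re0 simp del: times_complex.sel)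
  also have "\<dots> \<le> (U + (real k)\<^sup>2 * V) ^ k"
  proof (rule integral_power_add_le)
    show "integral {0..1} (\<lambda>x. ((norm (f x))\<^sup>2) ^ k) \<le> U ^ k"
      using UV by (simp add: moment_def f_def power_mult)
    have "integral {0..1} (\<lambda>x. ((real k * norm (g x))\<^sup>2) ^ k)
        = integral {0..1} (\<lambda>x. ((real k)\<^sup>2) ^ k * norm (g x) ^ (2 * k))"
      by (simp add: power_mult_distrib power_mult)
    also have "\<dots> = ((real k)\<^sup>2) ^ k * moment k B c"
      by (simp add: moment_def g_def)
    also have "\<dots> \<le> ((real k)\<^sup>2) ^ k * V ^ k"
      using UV by (intro mult_left_mono) auto
    finally show "integral {0..1} (\<lambda>x. ((real k * norm (g x))\<^sup>2) ^ k) \<le> ((real k)\<^sup>2 * V) ^ k"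
      by (simp add: power_mult_distrib)
  qed (use UV in \<open>auto intro!: continuous_intros\<close>)
  finally show ?thesis .
qed

lemma moment_Un_le:
  assumes "finite A" "finite B" "A \<inter> B = {}"
    and UV: "0 \<le> U" "0 \<le> V" "moment k A c \<le> U ^ (2 * k)" "moment k B c \<le> V ^ (2 * k)"
  shows "moment k (A \<union> B) c \<le> (U + V) ^ (2 * k)"
proof -
  have "moment k (A \<union> B) c
      \<le> integral {0..1} (\<lambda>x. (norm (trig_poly A c x) + norm (trig_poly B c x)) ^ (2 * k))"
    unfolding moment_def trig_poly_Un[OF assms(1-3)]
    by (intro integral_le integrable_continuous_real continuous_intros)
      (auto intro!: power_mono norm_triangle_ineq)
  also have "\<dots> \<le> (U + V) ^ (2 * k)"
    using UV by (intro integral_power_add_le continuous_intros) (auto simp: moment_def)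
  finally show ?thesis .
qed

section \<open>A weighted Prekopa-Leindler inequality on the integers\<close>

text \<open>
  The translates \<open>X + min Y\<close> and \<open>max X + Y\<close> both lie in the sumset and share one point only.
\<close>
lemma card_sumset_int_ge:
  fixes X Y D :: "int set"
  assumes "finite X" "finite Y" "X \<noteq> {}" "Y \<noteq> {}" "finite D"
    and D: "\<And>x y. x \<in> X \<Longrightarrow> y \<in> Y \<Longrightarrow> x + y \<in> D"
  shows "card X + card Y \<le> card D + 1"
proof -
  let ?U = "(\<lambda>x. x + Min Y) ` X" and ?V = "(\<lambda>y. Max X + y) ` Y"
  have "?U \<inter> ?V \<subseteq> {Max X + Min Y}"
  proof
    fix z assume "z \<in> ?U \<inter> ?V"
    then obtain x y where "x \<in> X" "y \<in> Y" "z = x + Min Y" "z = Max X + y" by auto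
    moreover have "x \<le> Max X" "Min Y \<le> y" using calculation assms by auto
    ultimately show "z \<in> {Max X + Min Y}" by simp
  qed
  then have "card (?U \<inter> ?V) \<le> 1" using card_mono[of "{Max X + Min Y}"] by simp
  moreover have "card (?U \<union> ?V) \<le> card D"
    using assms(1-5) by (intro card_mono) (auto intro!: D Min_in Max_in)
  moreover have "card ?U = card X" "card ?V = card Y"
    by (auto intro!: card_image simp: inj_on_def)
  ultimately show ?thesis
    using card_Un_Int[of ?U ?V] assms by simp
qed

lemma sum_eq_integral_card_levels:
  fixes h :: "'a \<Rightarrow> real"
  assumes "finite D" "\<And>d. d \<in> D \<Longrightarrow> 0 \<le> h d \<and> h d \<le> 1"
  shows "((\<lambda>t. real (card {d\<in>D. t < h d})) has_integral (\<Sum>d\<in>D. h d)) {0..1}"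
proof -
  have "((\<lambda>t. indicator {0..<h d} t) has_integral h d) {0..1}" if "d \<in> D" for d
  proof -
    have "((\<lambda>t. 1::real) has_integral h d) {0..h d}"
      using has_integral_const_real[of "1::real" 0 "h d"] assms(2)[OF that] by simp
    then have "((\<lambda>t. indicator {0..<h d} t :: real) has_integral h d) {0..h d}"
      by (intro has_integral_spike_finite[of "{h d}" "{0..h d}" "\<lambda>t. indicator {0..<h d} t" "\<lambda>t. 1"])
        (auto simp: indicator_def)
    then show ?thesis
      by (rule has_integral_on_superset) (use assms(2)[OF that] in \<open>auto simp: indicator_def\<close>)
  qed
  then have "((\<lambda>t. \<Sum>d\<in>D. indicator {0..<h d} t) has_integral (\<Sum>d\<in>D. h d)) {0..1}"
    by (intro has_integral_sum assms(1))
  then show ?thesis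
  proof (rule has_integral_eq[rotated])
    fix t :: real assume "t \<in> {0..1}"
    then have "(\<Sum>d\<in>D. indicator {0..<h d} t) = (\<Sum>d\<in>D. if t < h d then 1 else (0::real))"
      by (intro sum.cong) (auto simp: indicator_def)
    also have "\<dots> = real (card {d\<in>D. t < h d})"
      using assms(1) by (simp add: sum.If_cases Int_def)
    finally show "(\<Sum>d\<in>D. indicator {0..<h d} t) = real (card {d\<in>D. t < h d})" .
  qed
qed

text \<open>
  Layer-cake argument: the level set \<open>{h > t}\<close> contains \<open>{f > t} + {g > t}\<close>, and both summands are
  non-empty for \<open>t < 1\<close>. So its cardinality is at least the sum of theirs minus 1; integrate over \<open>t\<close>.
\<close>
lemma sum_min_convolution_ge:
  fixes f g h :: "int \<Rightarrow> real"
  assumes fin: "finite X" "finite Y" "finite D"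
    and f: "\<And>x. x \<in> X \<Longrightarrow> 0 \<le> f x \<and> f x \<le> 1" "x0 \<in> X" "f x0 = 1"
    and g: "\<And>y. y \<in> Y \<Longrightarrow> 0 \<le> g y \<and> g y \<le> 1" "y0 \<in> Y" "g y0 = 1"
    and h: "\<And>d. d \<in> D \<Longrightarrow> 0 \<le> h d"
      "\<And>x y. x \<in> X \<Longrightarrow> y \<in> Y \<Longrightarrow> x + y \<in> D \<and> min (f x) (g y) \<le> h (x + y)"
  shows "(\<Sum>x\<in>X. f x) + (\<Sum>y\<in>Y. g y) \<le> (\<Sum>d\<in>D. h d) + 1"
proof -
  define h' where "h' d = min (h d) 1" for d
  have "(\<Sum>x\<in>X. f x) + (\<Sum>y\<in>Y. g y) \<le> (\<Sum>d\<in>D. h' d) + 1"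
  proof (rule has_integral_le)
    show "((\<lambda>t. real (card {x\<in>X. t < f x}) + real (card {y\<in>Y. t < g y}))
        has_integral (\<Sum>x\<in>X. f x) + (\<Sum>y\<in>Y. g y)) {0..1}"
      using f(1) g(1) by (intro has_integral_add sum_eq_integral_card_levels fin)
    show "((\<lambda>t. real (card {d\<in>D. t < h' d}) + 1) has_integral (\<Sum>d\<in>D. h' d) + 1) {0..1}"
      using h(1) has_integral_const_real[of "1::real" 0 1]
      by (intro has_integral_add sum_eq_integral_card_levels fin) (auto simp: h'_def)
    fix t :: real assume t: "t \<in> {0..1}"
    show "real (card {x\<in>X. t < f x}) + real (card {y\<in>Y. t < g y}) \<le> real (card {d\<in>D. t < h' d}) + 1"
    proof (cases "t = 1")
      case True
      then have "{x\<in>X. t < f x} = {}" "{y\<in>Y. t < g y} = {}" using f(1) g(1) by force+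
      then show ?thesis by (simp only: card.empty)
    next
      case False
      then have "t < 1" using t by simp
      then have "card {x\<in>X. t < f x} + card {y\<in>Y. t < g y} \<le> card {d\<in>D. t < h' d} + 1"
        using fin f(2,3) g(2,3) h(2) by (intro card_sumset_int_ge) (force simp: h'_def)+
      then show ?thesis by linarith
    qed
  qed
  also have "(\<Sum>d\<in>D. h' d) \<le> (\<Sum>d\<in>D. h d)"
    by (intro sum_mono) (simp add: h'_def)
  finally show ?thesis by simp
qed

text \<open>
  After normalising the maxima to 1, \<open>F x * G y\<close> is at least the smaller of \<open>(F x)\<^sup>2\<close> and \<open>(G y)\<^sup>2\<close>,
  so the previous lemma applies to the squares; finish with \<open>2 a b \<le> a\<^sup>2 + b\<^sup>2\<close>. This is a discrete
  Prekopa-Leindler inequality. Its error term \<open>m * n\<close> stays bounded while the sums grow, which is why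
  it disappears in the blow-up below.
\<close>
lemma sum_product_convolution_ge:
  fixes F G H :: "int \<Rightarrow> real"
  assumes fin: "finite X" "finite Y" "finite D" and ne: "X \<noteq> {}" "Y \<noteq> {}"
    and F: "\<And>x. x \<in> X \<Longrightarrow> 0 \<le> F x \<and> F x \<le> m" and G: "\<And>y. y \<in> Y \<Longrightarrow> 0 \<le> G y \<and> G y \<le> n"
    and H: "\<And>d. d \<in> D \<Longrightarrow> 0 \<le> H d"
      "\<And>x y. x \<in> X \<Longrightarrow> y \<in> Y \<Longrightarrow> x + y \<in> D \<and> F x * G y \<le> H (x + y)"
  shows "2 * sqrt (\<Sum>x\<in>X. (F x)\<^sup>2) * sqrt (\<Sum>y\<in>Y. (G y)\<^sup>2) \<le> (\<Sum>d\<in>D. H d) + m * n"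
proof -
  define M N where "M = Max (F ` X)" and "N = Max (G ` Y)"
  have "M \<in> F ` X" "N \<in> G ` Y" unfolding M_def N_def using fin ne by (auto intro!: Max_in)
  then obtain x0 y0 where x0: "x0 \<in> X" "F x0 = M" and y0: "y0 \<in> Y" "G y0 = N" by auto
  have FM: "F x \<le> M" if "x \<in> X" for x using that fin by (simp add: M_def)
  have GN: "G y \<le> N" if "y \<in> Y" for y using that fin by (simp add: N_def)
  have MN: "0 \<le> M" "0 \<le> N" "M \<le> m" "N \<le> n" using F G x0 y0 by auto
  have sumH: "0 \<le> (\<Sum>d\<in>D. H d)" using H(1) by (intro sum_nonneg)
  have mn: "M * N \<le> m * n" using MN by (intro mult_mono) auto
  show ?thesis
  proof (cases "M = 0 \<or> N = 0")
    case True
    then have "(\<Sum>x\<in>X. (F x)\<^sup>2) = 0 \<or> (\<Sum>y\<in>Y. (G y)\<^sup>2) = 0"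
      using F G FM GN fin by (force simp: sum_nonneg_eq_0_iff)
    then show ?thesis using sumH mn MN mult_nonneg_nonneg[OF MN(1,2)] by auto
  next
    case False
    then have pos: "0 < M" "0 < N" using MN by auto
    define a b where "a = (\<Sum>x\<in>X. (F x)\<^sup>2)" and "b = (\<Sum>y\<in>Y. (G y)\<^sup>2)"
    have ab: "0 \<le> a" "0 \<le> b" by (auto simp: a_def b_def intro: sum_nonneg)
    have "(\<Sum>x\<in>X. (F x / M)\<^sup>2) + (\<Sum>y\<in>Y. (G y / N)\<^sup>2) \<le> (\<Sum>d\<in>D. H d / (M * N)) + 1"
    proof (rule sum_min_convolution_ge[OF fin, where ?x0.0 = x0 and ?y0.0 = y0])
      fix x y assume xy: "x \<in> X" "y \<in> Y"
      define p q where "p = F x / M" and "q = G y / N"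
      have pq: "0 \<le> p" "0 \<le> q" using F G xy pos by (auto simp: p_def q_def)
      have "min (p\<^sup>2) (q\<^sup>2) \<le> p * q"
        using pq by (cases "p \<le> q") (auto simp: power2_eq_square min_le_iff_disj intro: mult_left_mono mult_right_mono)
      also have "\<dots> \<le> H (x + y) / (M * N)"
        using H(2)[OF xy] pos by (simp add: p_def q_def divide_right_mono)
      finally show "x + y \<in> D \<and> min ((F x / M)\<^sup>2) ((G y / N)\<^sup>2) \<le> H (x + y) / (M * N)"
        using H(2)[OF xy] by (simp add: p_def q_def)
    qed (use F G H(1) FM GN pos x0 y0 in \<open>auto simp: power_le_one\<close>)
    then have 1: "a / M\<^sup>2 + b / N\<^sup>2 \<le> (\<Sum>d\<in>D. H d) / (M * N) + 1"
      by (simp add: a_def b_def power_divide sum_divide_distrib)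
    have "2 * (sqrt a / M) * (sqrt b / N) \<le> (sqrt a / M)\<^sup>2 + (sqrt b / N)\<^sup>2"
      by (rule sum_squares_bound)
    also have "\<dots> = a / M\<^sup>2 + b / N\<^sup>2" using ab by (simp add: power_divide)
    finally have "2 * (sqrt a / M) * (sqrt b / N) * (M * N) \<le> ((\<Sum>d\<in>D. H d) / (M * N) + 1) * (M * N)"
      using 1 pos by (intro mult_right_mono) auto
    also have "2 * (sqrt a / M) * (sqrt b / N) * (M * N) = 2 * sqrt a * sqrt b"
      using pos by simp
    also have "((\<Sum>d\<in>D. H d) / (M * N) + 1) * (M * N) = (\<Sum>d\<in>D. H d) + M * N"
      using pos by (simp add: distrib_right)
    finally have "2 * sqrt a * sqrt b \<le> (\<Sum>d\<in>D. H d) + M * N" .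
    then show ?thesis using mn by (simp add: a_def b_def)
  qed
qed

lemma sum_blocks:
  fixes S :: "int set" and K :: nat and \<phi> :: "int \<Rightarrow> real"
  assumes "finite S" "K > 0"
  shows "(\<Sum>z\<in>{z. z div int K \<in> S}. \<phi> (z div int K) * r ^ nat (z mod int K))
    = (\<Sum>s\<in>S. \<phi> s) * (\<Sum>i<K. r ^ i)"
    and "finite {z. z div int K \<in> S}"
proof -
  have bij: "bij_betw (\<lambda>(s, i). int K * s + int i) (S \<times> {..<K}) {z. z div int K \<in> S}"
    using assms(2)
    by (intro bij_betwI[where g = "\<lambda>z. (z div int K, nat (z mod int K))"])
      (auto simp: nat_less_iff)
  then show "finite {z. z div int K \<in> S}"
    using assms(1) bij_betw_finite by blast
  have "(\<Sum>z\<in>{z. z div int K \<in> S}. \<phi> (z div int K) * r ^ nat (z mod int K))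
      = (\<Sum>(s, i)\<in>S \<times> {..<K}. \<phi> s * r ^ i)"
    using assms(2) by (subst sum.reindex_bij_betw[OF bij, symmetric]) (auto intro!: sum.cong)
  then show "(\<Sum>z\<in>{z. z div int K \<in> S}. \<phi> (z div int K) * r ^ nat (z mod int K))
      = (\<Sum>s\<in>S. \<phi> s) * (\<Sum>i<K. r ^ i)"
    by (simp add: sum_product sum.cartesian_product)
qed

lemma sum_power_double:
  fixes q :: real
  shows "(1 + q) * (\<Sum>i<K. (q\<^sup>2) ^ i) = (1 + q ^ K) * (\<Sum>i<K. q ^ i)"
proof (induction K)
  case (Suc K)
  have geometric: "(\<Sum>i<K. q ^ i) + q ^ K = 1 + q * (\<Sum>i<K. q ^ i)"
  proof (induction K)
    case (Suc K)
    then have "(\<Sum>i<K. q ^ i) + q ^ K + q * q ^ K = 1 + q * (\<Sum>i<K. q ^ i) + q * q ^ K" by simp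
    then show ?case by (simp only: sum.lessThan_Suc power_Suc distrib_left add.assoc)
  qed simp
  have "(1 + q) * (P + t * t) = (1 + q * t) * (Q + t)"
    if "Q + t = 1 + q * Q" "(1 + q) * P = (1 + t) * Q" for P Q t :: real
    using that by algebra
  from this[OF geometric Suc.IH] show ?case
    by (simp add: power2_eq_square power_mult_distrib)
qed simp

text \<open>
  Each integer is replaced by a block of \<open>K\<close> points carrying the geometric weights
  \<open>1, q, \<dots>, q\<^sup>K\<^sup>-\<^sup>1\<close> with \<open>q\<^sup>K = \<delta>\<close>. If the offsets \<open>i\<close> and \<open>j\<close> of two points add up without carry, the
  weights multiply to that of offset \<open>i + j\<close> in block \<open>s + t\<close>; with a carry they multiply to \<open>\<delta>\<close>
  times that of offset \<open>i + j - K\<close> in block \<open>s + t + 1\<close>. Hence the two hypotheses on \<open>N\<close> together say that the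
  blown-up functions satisfy the unweighted inequality, and the gain \<open>1 + \<delta>\<close> is the quotient
  \<open>(1 + q) \<Sum>q\<^sup>2\<^sup>i / \<Sum>q\<^sup>i\<close>.
\<close>
lemma weighted_Prekopa_Leindler_blowup:
  fixes b c N :: "int \<Rightarrow> real"
  assumes fin: "finite S" "finite T" "finite D" and ne: "S \<noteq> {}" "T \<noteq> {}" and K: "K > 0"
    and q: "0 < q" "q ^ K = \<delta>"
    and b: "\<And>s. s \<in> S \<Longrightarrow> 0 \<le> b s \<and> b s \<le> m" and c: "\<And>t. t \<in> T \<Longrightarrow> 0 \<le> c t \<and> c t \<le> n"
    and N: "\<And>d. d \<in> D \<Longrightarrow> 0 \<le> N d"
      "\<And>s t. s \<in> S \<Longrightarrow> t \<in> T \<Longrightarrow> s + t \<in> D \<and> b s * c t \<le> N (s + t)"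
      "\<And>s t. s \<in> S \<Longrightarrow> t \<in> T \<Longrightarrow> s + t + 1 \<in> D \<and> \<delta> * (b s * c t) \<le> N (s + t + 1)"
  shows "2 * (1 + \<delta>) * sqrt (\<Sum>s\<in>S. (b s)\<^sup>2) * sqrt (\<Sum>t\<in>T. (c t)\<^sup>2)
    \<le> (1 + q) * ((\<Sum>d\<in>D. N d) + m * n * (max 1 \<delta>)\<^sup>2 / (real K * min 1 \<delta>))"
proof -
  define Q P where "Q = (\<Sum>i<K. q ^ i)" and "P = (\<Sum>i<K. (q\<^sup>2) ^ i)"
  define a a' where "a = (\<Sum>s\<in>S. (b s)\<^sup>2)" and "a' = (\<Sum>t\<in>T. (c t)\<^sup>2)"
  have a: "0 \<le> a" "0 \<le> a'" by (auto simp: a_def a'_def intro: sum_nonneg)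
  have m: "0 \<le> m" "0 \<le> n" using b c ne by force+
  have \<delta>: "0 < \<delta>" using q by auto
  have qi: "min 1 \<delta> \<le> q ^ i" "q ^ i \<le> max 1 \<delta>" if "i < K" for i
  proof -
    \<comment> \<open>\<open>q\<close> may lie on either side of 1, so all weights lie between 1 and \<open>\<delta>\<close> in one of the two orders.\<close>
    have "1 \<le> q ^ i \<and> q ^ i \<le> q ^ K \<or> q ^ K \<le> q ^ i \<and> q ^ i \<le> 1"
      using q that by (cases "q \<le> 1") (auto intro: power_decreasing power_increasing power_le_one one_le_power)
    then show "min 1 \<delta> \<le> q ^ i" "q ^ i \<le> max 1 \<delta>" using q by auto
  qed
  have Q: "real K * min 1 \<delta> \<le> Q"
    unfolding Q_def using sum_bounded_below[of "{..<K}" "min 1 \<delta>" "\<lambda>i. q ^ i"] qi by simp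
  have Kd: "0 < real K * min 1 \<delta>" using K \<delta> by simp
  have modK: "nat (z mod int K) < K" for z using K by (simp add: nat_less_iff)
  define X Y E where "X = {z. z div int K \<in> S}" and "Y = {z. z div int K \<in> T}" and "E = {z. z div int K \<in> D}"
  have finXYE: "finite X" "finite Y" "finite E"
    unfolding X_def Y_def E_def using fin K by (auto intro: sum_blocks(2))
  have "2 * sqrt (\<Sum>x\<in>X. (b (x div int K) * q ^ nat (x mod int K))\<^sup>2)
          * sqrt (\<Sum>y\<in>Y. (c (y div int K) * q ^ nat (y mod int K))\<^sup>2)
      \<le> (\<Sum>z\<in>E. N (z div int K) * q ^ nat (z mod int K)) + (m * max 1 \<delta>) * (n * max 1 \<delta>)"
  proof (rule sum_product_convolution_ge)
    show "finite X" "finite Y" "finite E" using finXYE .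
    obtain s t where "s \<in> S" "t \<in> T" using ne by auto
    then have "int K * s \<in> X" "int K * t \<in> Y" using K by (auto simp: X_def Y_def)
    then show "X \<noteq> {}" "Y \<noteq> {}" by auto
    show "0 \<le> b (x div int K) * q ^ nat (x mod int K) \<and> b (x div int K) * q ^ nat (x mod int K) \<le> m * max 1 \<delta>"
      if "x \<in> X" for x
      using that b qi(2)[OF modK] q m by (auto simp: X_def intro!: mult_mono)
    show "0 \<le> c (x div int K) * q ^ nat (x mod int K) \<and> c (x div int K) * q ^ nat (x mod int K) \<le> n * max 1 \<delta>"
      if "x \<in> Y" for x
      using that c qi(2)[OF modK] q m by (auto simp: Y_def intro!: mult_mono)
    show "0 \<le> N (z div int K) * q ^ nat (z mod int K)" if "z \<in> E" for z
      using that N(1) q by (auto simp: E_def)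
    fix x y assume "x \<in> X" "y \<in> Y"
    define s i t j where "s = x div int K" "i = nat (x mod int K)" "t = y div int K" "j = nat (y mod int K)"
    have st: "s \<in> S" "t \<in> T" using \<open>x \<in> X\<close> \<open>y \<in> Y\<close> by (auto simp: X_def Y_def s_i_t_j_def)
    have ij: "i < K" "j < K" using modK by (auto simp: s_i_t_j_def)
    have x: "x = int K * s + int i" and y: "y = int K * t + int j"
      using K by (auto simp: s_i_t_j_def)
    have F: "b s * q ^ i * (c t * q ^ j) = b s * c t * q ^ (i + j)" by (simp add: power_add)
    have "x + y \<in> E \<and> b s * q ^ i * (c t * q ^ j) \<le> N ((x + y) div int K) * q ^ nat ((x + y) mod int K)"
    proof (cases "i + j < K")
      case True
      have xy: "x + y = int (i + j) + int K * (s + t)" using x y by (simp add: algebra_simps)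
      have dm: "(x + y) div int K = s + t" "(x + y) mod int K = int (i + j)"
        unfolding xy using True K by (simp_all del: of_nat_add)
      show ?thesis
        unfolding F dm nat_int using N(2)[OF st] dm q by (auto simp: E_def intro!: mult_right_mono)
    next
      case False
      have xy: "x + y = int (i + j - K) + int K * (s + t + 1)"
        using x y False by (simp add: algebra_simps of_nat_diff)
      have l: "i + j - K < K" using ij by simp
      have dm: "(x + y) div int K = s + t + 1" "(x + y) mod int K = int (i + j - K)"
        unfolding xy using l K by (simp_all del: of_nat_diff)
      have "q ^ (i + j) = q ^ K * q ^ (i + j - K)"
        using False by (simp add: power_add[symmetric])
      then have "b s * c t * q ^ (i + j) = \<delta> * (b s * c t) * q ^ (i + j - K)"
        using q by simp
      also have "\<dots> \<le> N (s + t + 1) * q ^ (i + j - K)"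
        using N(3)[OF st] q by (intro mult_right_mono) auto
      finally show ?thesis
        unfolding F dm using N(3)[OF st] dm by (auto simp: E_def)
    qed
    then show "x + y \<in> E \<and> b (x div int K) * q ^ nat (x mod int K) * (c (y div int K) * q ^ nat (y mod int K))
        \<le> N ((x + y) div int K) * q ^ nat ((x + y) mod int K)"
      by (simp add: s_i_t_j_def)
  qed
  also have "(\<Sum>x\<in>X. (b (x div int K) * q ^ nat (x mod int K))\<^sup>2) = a * P"
    using sum_blocks(1)[OF fin(1) K, of "\<lambda>s. (b s)\<^sup>2" "q\<^sup>2"]
    by (simp add: X_def a_def P_def power_mult_distrib power_mult[symmetric] mult.commute)
  also have "(\<Sum>y\<in>Y. (c (y div int K) * q ^ nat (y mod int K))\<^sup>2) = a' * P"
    using sum_blocks(1)[OF fin(2) K, of "\<lambda>s. (c s)\<^sup>2" "q\<^sup>2"]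
    by (simp add: Y_def a'_def P_def power_mult_distrib power_mult[symmetric] mult.commute)
  also have "(\<Sum>z\<in>E. N (z div int K) * q ^ nat (z mod int K)) = (\<Sum>d\<in>D. N d) * Q"
    using sum_blocks(1)[OF fin(3) K, of N q] by (simp add: E_def Q_def)
  also have "2 * sqrt (a * P) * sqrt (a' * P) = 2 * sqrt a * sqrt a' * P"
    using q by (simp add: real_sqrt_mult P_def sum_nonneg)
  finally have "(1 + q) * (2 * sqrt a * sqrt a' * P)
      \<le> (1 + q) * ((\<Sum>d\<in>D. N d) * Q + m * n * (max 1 \<delta>)\<^sup>2)"
    using q by (intro mult_left_mono) (auto simp: power2_eq_square mult_ac)
  also have "(1 + q) * (2 * sqrt a * sqrt a' * P) = 2 * (1 + \<delta>) * sqrt a * sqrt a' * Q"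
  proof -
    have "(1 + q) * P = (1 + \<delta>) * Q"
      using sum_power_double[of q K] q by (simp add: P_def Q_def)
    then show ?thesis by algebra
  qed
  finally have "2 * (1 + \<delta>) * sqrt a * sqrt a' * Q
      \<le> (1 + q) * ((\<Sum>d\<in>D. N d) * Q + m * n * (max 1 \<delta>)\<^sup>2)" .
  then have "2 * (1 + \<delta>) * sqrt a * sqrt a'
      \<le> (1 + q) * ((\<Sum>d\<in>D. N d) + m * n * (max 1 \<delta>)\<^sup>2 / Q)"
    using Q Kd by (simp add: field_simps)
  also have "\<dots> \<le> (1 + q) * ((\<Sum>d\<in>D. N d) + m * n * (max 1 \<delta>)\<^sup>2 / (real K * min 1 \<delta>))"
    using Q Kd q m by (intro mult_left_mono add_left_mono divide_left_mono) auto
  finally show ?thesis by (simp add: a_def a'_def)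
qed

text \<open>
  Let \<open>K\<close> tend to infinity in the blow-up: \<open>q\<close>, the \<open>K\<close>-th root of \<open>\<delta>\<close>, tends to 1 and the error
  term vanishes.
\<close>
lemma weighted_Prekopa_Leindler_gap_one:
  fixes b c N :: "int \<Rightarrow> real"
  assumes fin: "finite S" "finite T" "finite D" and uv: "0 < u" "0 < v"
    and b: "\<And>s. s \<in> S \<Longrightarrow> 0 \<le> b s" and c: "\<And>t. t \<in> T \<Longrightarrow> 0 \<le> c t"
    and N: "\<And>d. d \<in> D \<Longrightarrow> 0 \<le> N d"
      "\<And>s t. s \<in> S \<Longrightarrow> t \<in> T \<Longrightarrow> s + t \<in> D \<and> u * (b s * c t) \<le> N (s + t)"
      "\<And>s t. s \<in> S \<Longrightarrow> t \<in> T \<Longrightarrow> s + t + 1 \<in> D \<and> v * (b s * c t) \<le> N (s + t + 1)"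
  shows "(u + v) * (sqrt (\<Sum>s\<in>S. (b s)\<^sup>2) * sqrt (\<Sum>t\<in>T. (c t)\<^sup>2)) \<le> (\<Sum>d\<in>D. N d)"
proof (cases "S = {} \<or> T = {}")
  case True
  then show ?thesis using sum_nonneg[of D N] N(1) by auto
next
  case False
  define \<delta> where "\<delta> = v / u"
  have \<delta>: "0 < \<delta>" using uv by (simp add: \<delta>_def)
  define R where "R = sqrt (\<Sum>s\<in>S. (b s)\<^sup>2) * sqrt (\<Sum>t\<in>T. (c t)\<^sup>2)"
  define W where "W = (\<Sum>d\<in>D. N d / u)"
  \<comment> \<open>The error term of the blow-up is \<open>z / K\<close>.\<close>
  define z where "z = Max (b ` S) * Max (c ` T) * (max 1 \<delta>)\<^sup>2 / min 1 \<delta>"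
  have "2 * (1 + \<delta>) * R \<le> (1 + root K \<delta>) * (W + z / real K)" if "K \<ge> 1" for K
  proof -
    have "2 * (1 + \<delta>) * sqrt (\<Sum>s\<in>S. (b s)\<^sup>2) * sqrt (\<Sum>t\<in>T. (c t)\<^sup>2)
        \<le> (1 + root K \<delta>) * (W + Max (b ` S) * Max (c ` T) * (max 1 \<delta>)\<^sup>2 / (real K * min 1 \<delta>))"
      unfolding W_def
    proof (rule weighted_Prekopa_Leindler_blowup[OF fin])
      show "S \<noteq> {}" "T \<noteq> {}" "0 < K" using False that by auto
      show "0 < root K \<delta>" "root K \<delta> ^ K = \<delta>" using \<delta> that by auto
      fix s t assume st: "s \<in> S" "t \<in> T"
      show "s + t \<in> D \<and> b s * c t \<le> N (s + t) / u"
        using N(2)[OF st] uv by (simp add: field_simps)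
      show "s + t + 1 \<in> D \<and> \<delta> * (b s * c t) \<le> N (s + t + 1) / u"
        using N(3)[OF st] uv by (simp add: field_simps \<delta>_def)
    qed (use b c N(1) fin uv in auto)
    also have "Max (b ` S) * Max (c ` T) * (max 1 \<delta>)\<^sup>2 / (real K * min 1 \<delta>) = z / real K"
      by (simp add: z_def)
    finally show ?thesis by (simp add: R_def mult.assoc)
  qed
  then have "\<forall>\<^sub>F K in sequentially. 2 * (1 + \<delta>) * R \<le> (1 + root K \<delta>) * (W + z / real K)"
    by (auto simp: eventually_sequentially)
  moreover have "(\<lambda>K. (1 + root K \<delta>) * (W + z / real K)) \<longlonglongrightarrow> (1 + 1) * (W + 0)"
    by (intro tendsto_intros LIMSEQ_root_const[OF \<delta>] lim_const_over_n)
  ultimately have "2 * (1 + \<delta>) * R \<le> (1 + 1) * (W + 0)"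
    by (intro tendsto_lowerbound[where F = sequentially]) auto
  then have "(1 + \<delta>) * R \<le> W" by (simp add: distrib_right)
  then have "u * ((1 + \<delta>) * R) \<le> u * W" using uv by (intro mult_left_mono) auto
  moreover have "u * W = (\<Sum>d\<in>D. N d)" using uv by (simp add: W_def sum_divide_distrib[symmetric])
  moreover have "u * (1 + \<delta>) = u + v" using uv by (simp add: \<delta>_def field_simps)
  then have "u * ((1 + \<delta>) * R) = (u + v) * R" by (simp add: mult.assoc[symmetric])
  ultimately show ?thesis unfolding R_def by simp
qed

text \<open>
  For a gap \<open>g = j - i\<close> the functions are cut into residue classes modulo \<open>g\<close>, and the case of gap one
  applies to each pair of classes. With \<open>x r\<close> and \<open>y r\<close> the \<open>\<ell>\<^sup>2\<close> norms on the classes, it remains to see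
  that \<open>\<Sum>\<rho>. max (x r * y r')\<close> over \<open>r + r' = \<rho>\<close> is at least the product of the \<open>\<ell>\<^sup>2\<close> norms of \<open>x\<close> and \<open>y\<close>.
  Fixing \<open>r\<close> to maximise \<open>x\<close> gives the lower bound \<open>max x * \<Sum>y\<close>, and symmetrically \<open>max y * \<Sum>x\<close>; the
  geometric mean of the two suffices because \<open>\<Sum>x\<^sup>2 \<le> max x * \<Sum>x\<close>.
\<close>
lemma weighted_Prekopa_Leindler_less:
  fixes b c N :: "int \<Rightarrow> real"
  assumes fin: "finite S" "finite T" "finite D" and uv: "0 < u" "0 < v" and ij: "i < j"
    and b: "\<And>s. s \<in> S \<Longrightarrow> 0 \<le> b s" and c: "\<And>t. t \<in> T \<Longrightarrow> 0 \<le> c t"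
    and N: "\<And>d. d \<in> D \<Longrightarrow> 0 \<le> N d"
      "\<And>s t. s \<in> S \<Longrightarrow> t \<in> T \<Longrightarrow> i + s + t \<in> D \<and> u * (b s * c t) \<le> N (i + s + t)"
      "\<And>s t. s \<in> S \<Longrightarrow> t \<in> T \<Longrightarrow> j + s + t \<in> D \<and> v * (b s * c t) \<le> N (j + s + t)"
  shows "(u + v) * (sqrt (\<Sum>s\<in>S. (b s)\<^sup>2) * sqrt (\<Sum>t\<in>T. (c t)\<^sup>2)) \<le> (\<Sum>d\<in>D. N d)"
proof -
  define g where "g = j - i"
  have g: "g > 0" using ij by (simp add: g_def)
  define x y where "x r = sqrt (\<Sum>s\<in>{s\<in>S. s mod g = r}. (b s)\<^sup>2)"
    and "y r = sqrt (\<Sum>t\<in>{t\<in>T. t mod g = r}. (c t)\<^sup>2)" for r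
  define C where "C r = (\<Sum>d\<in>{d\<in>D. (d - i) mod g = r}. N d)" for r
  define I where "I = {0..<g}"
  have I: "finite I" "I \<noteq> {}" "z mod g \<in> I" for z using g by (auto simp: I_def)
  have residue_sum: "(\<Sum>d\<in>{\<sigma>. g * \<sigma> + r \<in> S}. f (g * d + r)) = (\<Sum>s\<in>{s\<in>S. s mod g = r mod g}. f s)"
    "finite {\<sigma>. g * \<sigma> + r \<in> S}" if "finite S" for f :: "int \<Rightarrow> real" and r S
  proof -
    have bij: "bij_betw (\<lambda>\<sigma>. g * \<sigma> + r) {\<sigma>. g * \<sigma> + r \<in> S} {s\<in>S. s mod g = r mod g}"
    proof (rule bij_betwI[where g = "\<lambda>s. (s - r) div g"])
      show "(\<lambda>s. (s - r) div g) \<in> {s \<in> S. s mod g = r mod g} \<rightarrow> {\<sigma>. g * \<sigma> + r \<in> S}"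
        by (auto simp: mod_eq_dvd_iff)
    qed (use g in \<open>auto simp: mod_eq_dvd_iff\<close>)
    then show "finite {\<sigma>. g * \<sigma> + r \<in> S}" using that bij_betw_finite by fastforce
    show "(\<Sum>d\<in>{\<sigma>. g * \<sigma> + r \<in> S}. f (g * d + r)) = (\<Sum>s\<in>{s\<in>S. s mod g = r mod g}. f s)"
      by (rule sum.reindex_bij_betw[OF bij])
  qed
  have pair: "(u + v) * (x r * y r') \<le> C ((r + r') mod g)" if r: "r \<in> I" "r' \<in> I" for r r'
  proof -
    have "(u + v) * (sqrt (\<Sum>\<sigma>\<in>{\<sigma>. g * \<sigma> + r \<in> S}. (b (g * \<sigma> + r))\<^sup>2)
            * sqrt (\<Sum>\<tau>\<in>{\<tau>. g * \<tau> + r' \<in> T}. (c (g * \<tau> + r'))\<^sup>2))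
        \<le> (\<Sum>d\<in>{d. g * d + (i + r + r') \<in> D}. N (g * d + (i + r + r')))"
    proof (rule weighted_Prekopa_Leindler_gap_one)
      fix s t assume "s \<in> {\<sigma>. g * \<sigma> + r \<in> S}" "t \<in> {\<tau>. g * \<tau> + r' \<in> T}"
      then have st: "g * s + r \<in> S" "g * t + r' \<in> T" by auto
      have e1: "i + (g * s + r) + (g * t + r') = g * (s + t) + (i + r + r')" by (simp add: algebra_simps)
      show "s + t \<in> {d. g * d + (i + r + r') \<in> D}
          \<and> u * (b (g * s + r) * c (g * t + r')) \<le> N (g * (s + t) + (i + r + r'))"
        using N(2)[OF st] unfolding e1 by simp
      have e2: "j + (g * s + r) + (g * t + r') = g * (s + t + 1) + (i + r + r')"
        by (simp add: g_def algebra_simps)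
      show "s + t + 1 \<in> {d. g * d + (i + r + r') \<in> D}
          \<and> v * (b (g * s + r) * c (g * t + r')) \<le> N (g * (s + t + 1) + (i + r + r'))"
        using N(3)[OF st] unfolding e2 by simp
    qed (use fin uv b c N(1) in \<open>auto intro: residue_sum(2)\<close>)
    also have "(\<Sum>\<sigma>\<in>{\<sigma>. g * \<sigma> + r \<in> S}. (b (g * \<sigma> + r))\<^sup>2) = (\<Sum>s\<in>{s\<in>S. s mod g = r}. (b s)\<^sup>2)"
      using residue_sum(1)[OF fin(1), of "\<lambda>s. (b s)\<^sup>2" r] r by (simp add: I_def)
    also have "(\<Sum>\<tau>\<in>{\<tau>. g * \<tau> + r' \<in> T}. (c (g * \<tau> + r'))\<^sup>2) = (\<Sum>t\<in>{t\<in>T. t mod g = r'}. (c t)\<^sup>2)"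
      using residue_sum(1)[OF fin(2), of "\<lambda>s. (c s)\<^sup>2" r'] r by (simp add: I_def)
    also have "(\<Sum>d\<in>{d. g * d + (i + r + r') \<in> D}. N (g * d + (i + r + r'))) = C ((r + r') mod g)"
    proof -
      have "d mod g = (i + r + r') mod g \<longleftrightarrow> (d - i) mod g = (r + r') mod g" for d
        by (simp add: mod_eq_dvd_iff algebra_simps)
      then show ?thesis using residue_sum(1)[OF fin(3), of N "i + r + r'"] by (simp add: C_def)
    qed
    finally show ?thesis by (simp add: x_def y_def)
  qed
  have xy0: "0 \<le> x r" "0 \<le> y r" for r by (auto simp: x_def y_def intro: sum_nonneg)
  have sumC: "(\<Sum>r\<in>I. C ((r0 + r) mod g)) = (\<Sum>d\<in>D. N d)" for r0
  proof -
    have "bij_betw (\<lambda>r. (r0 + r) mod g) I I"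
      by (rule bij_betwI[where g = "\<lambda>r. (r - r0) mod g"]) (use g in \<open>auto simp: I_def mod_simps\<close>)
    then have "(\<Sum>r\<in>I. C ((r0 + r) mod g)) = (\<Sum>r\<in>I. C r)" by (rule sum.reindex_bij_betw)
    also have "\<dots> = (\<Sum>d\<in>D. N d)"
      unfolding C_def using fin(3) I by (intro sum.group) auto
    finally show ?thesis .
  qed
  define mx my where "mx = Max (x ` I)" and "my = Max (y ` I)"
  have "mx \<in> x ` I" "my \<in> y ` I" unfolding mx_def my_def using I by (auto intro!: Max_in)
  then obtain r0 r1 where r0: "r0 \<in> I" "x r0 = mx" and r1: "r1 \<in> I" "y r1 = my" by auto
  define W where "W = (\<Sum>d\<in>D. N d)"
  have W0: "0 \<le> W" using N(1) by (auto simp: W_def intro: sum_nonneg)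
  have Wx: "(u + v) * (mx * (\<Sum>r\<in>I. y r)) \<le> W"
    unfolding W_def sumC[of r0, symmetric] sum_distrib_left r0(2)[symmetric]
    using pair r0 by (intro sum_mono) auto
  have Wy: "(u + v) * (my * (\<Sum>r\<in>I. x r)) \<le> W"
    unfolding W_def sumC[of r1, symmetric] sum_distrib_left r1(2)[symmetric]
    using pair r1 by (intro sum_mono) (auto simp: mult.commute add.commute)
  have "(\<Sum>s\<in>S. (b s)\<^sup>2) = (\<Sum>r\<in>I. (x r)\<^sup>2)"
    using sum.group[OF fin(1) I(1), of "\<lambda>s. s mod g" "\<lambda>s. (b s)\<^sup>2"] I(3)
    by (simp add: x_def sum_nonneg image_subset_iff)
  also have "\<dots> \<le> mx * (\<Sum>r\<in>I. x r)"
    unfolding sum_distrib_left power2_eq_square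
    using xy0 I by (intro sum_mono mult_right_mono) (auto simp: mx_def)
  finally have X: "(\<Sum>s\<in>S. (b s)\<^sup>2) \<le> mx * (\<Sum>r\<in>I. x r)" .
  have "(\<Sum>s\<in>T. (c s)\<^sup>2) = (\<Sum>r\<in>I. (y r)\<^sup>2)"
    using sum.group[OF fin(2) I(1), of "\<lambda>s. s mod g" "\<lambda>s. (c s)\<^sup>2"] I(3)
    by (simp add: y_def sum_nonneg image_subset_iff)
  also have "\<dots> \<le> my * (\<Sum>r\<in>I. y r)"
    unfolding sum_distrib_left power2_eq_square
    using xy0 I by (intro sum_mono mult_right_mono) (auto simp: my_def)
  finally have Y: "(\<Sum>s\<in>T. (c s)\<^sup>2) \<le> my * (\<Sum>r\<in>I. y r)" .
  have m0: "0 \<le> mx" "0 \<le> my" using xy0 r0 r1 by auto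
  have "((u + v) * (sqrt (\<Sum>s\<in>S. (b s)\<^sup>2) * sqrt (\<Sum>t\<in>T. (c t)\<^sup>2)))\<^sup>2
      = (u + v)\<^sup>2 * ((\<Sum>s\<in>S. (b s)\<^sup>2) * (\<Sum>t\<in>T. (c t)\<^sup>2))"
    by (simp add: power_mult_distrib sum_nonneg)
  also have "\<dots> \<le> (u + v)\<^sup>2 * ((mx * (\<Sum>r\<in>I. x r)) * (my * (\<Sum>r\<in>I. y r)))"
    using m0 xy0 X Y by (intro mult_left_mono mult_mono) (auto intro!: sum_nonneg mult_nonneg_nonneg)
  also have "\<dots> = ((u + v) * (mx * (\<Sum>r\<in>I. y r))) * ((u + v) * (my * (\<Sum>r\<in>I. x r)))"
    by (simp add: power2_eq_square)
  also have "\<dots> \<le> W * W"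
    using Wx Wy W0 uv m0 xy0 by (intro mult_mono) (auto intro!: mult_nonneg_nonneg sum_nonneg)
  also have "W * W = W\<^sup>2" by (simp add: power2_eq_square)
  finally show ?thesis
    unfolding W_def[symmetric] by (rule power2_le_imp_le[OF _ W0])
qed

text \<open>
  Two-point form of the weighted discrete Prekopa-Leindler inequality; the one-point form,
  without \<open>v\<close>, would only give the factor \<open>u\<close>. Additivity \<open>u + v\<close> is the source
  of the superadditivity of \<^const>\<open>beta_star\<close> over fibres.
\<close>
lemma weighted_Prekopa_Leindler:
  fixes b c N :: "int \<Rightarrow> real"
  assumes fin: "finite S" "finite T" "finite D" and uv: "0 < u" "0 < v" and ij: "i \<noteq> j"
    and b: "\<And>s. s \<in> S \<Longrightarrow> 0 \<le> b s" and c: "\<And>t. t \<in> T \<Longrightarrow> 0 \<le> c t"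
    and N: "\<And>d. d \<in> D \<Longrightarrow> 0 \<le> N d"
      "\<And>s t. s \<in> S \<Longrightarrow> t \<in> T \<Longrightarrow> i + s + t \<in> D \<and> u * (b s * c t) \<le> N (i + s + t)"
      "\<And>s t. s \<in> S \<Longrightarrow> t \<in> T \<Longrightarrow> j + s + t \<in> D \<and> v * (b s * c t) \<le> N (j + s + t)"
  shows "(u + v) * (sqrt (\<Sum>s\<in>S. (b s)\<^sup>2) * sqrt (\<Sum>t\<in>T. (c t)\<^sup>2)) \<le> (\<Sum>d\<in>D. N d)"
proof (cases "i < j")
  case True
  from weighted_Prekopa_Leindler_less[OF fin uv this b c N] show ?thesis .
next
  case False
  then have "j < i" using ij by simp
  from weighted_Prekopa_Leindler_less[OF fin uv(2,1) this b c N(1,3,2)] show ?thesis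
    by (simp add: add.commute)
qed

section \<open>The product-set constant and prime valuations\<close>

lemma beta_star_mult_le:
  assumes "finite B" "0 \<notin> B" "finite C" "0 \<notin> C"
  shows "beta_star A * (sqrt (card B) * sqrt (card C)) \<le> card (A * B * C)"
proof (cases "B = {} \<or> C = {}")
  case False
  then have pos: "0 < sqrt (card B) * sqrt (card C)"
    using assms by (simp add: card_gt_0_iff)
  have "beta_star A \<le> card (A * B * C) / (sqrt (card B) * sqrt (card C))"
    unfolding beta_star_def
    by (rule cINF_lower2[where x = "(B, C)"])
      (use assms False in \<open>auto simp: powr_half_sqrt intro!: bdd_belowI[where m = 0]\<close>)
  then show ?thesis using pos by (simp add: pos_le_divide_eq)
qed auto

lemma beta_star_greatest:
  assumes "\<And>B C. finite B \<Longrightarrow> B \<noteq> {} \<Longrightarrow> 0 \<notin> B \<Longrightarrow> finite C \<Longrightarrow> C \<noteq> {} \<Longrightarrow> 0 \<notin> C \<Longrightarrow>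
      z * (sqrt (card B) * sqrt (card C)) \<le> card (A * B * C)"
  shows "z \<le> beta_star A"
  unfolding beta_star_def
proof (rule cINF_greatest)
  have "({1 :: int}, {1 :: int}) \<in> {(B, C). finite B \<and> B \<noteq> {} \<and> (0 :: int) \<notin> B \<and> finite C \<and> C \<noteq> {} \<and> (0 :: int) \<notin> C}"
    by simp
  then show "{(B, C). finite B \<and> B \<noteq> {} \<and> (0 :: int) \<notin> B \<and> finite C \<and> C \<noteq> {} \<and> (0 :: int) \<notin> C} \<noteq> {}"
    by blast
next
  fix BC :: "int set \<times> int set"
  assume "BC \<in> {(B, C). finite B \<and> B \<noteq> {} \<and> 0 \<notin> B \<and> finite C \<and> C \<noteq> {} \<and> 0 \<notin> C}"
  then obtain B C where BC: "BC = (B, C)" "finite B" "B \<noteq> {}" "0 \<notin> B" "finite C" "C \<noteq> {}" "0 \<notin> C"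
    by auto
  then have "0 < sqrt (card B) * sqrt (card C)" by (simp add: card_gt_0_iff)
  then show "z \<le> (case BC of (B, C) \<Rightarrow>
      real (card (A * B * C)) / (real (card B) powr (1/2) * real (card C) powr (1/2)))"
    using assms[of B C] BC by (simp add: powr_half_sqrt pos_le_divide_eq)
qed

lemma beta_star_mono:
  assumes "A' \<subseteq> A" "finite A"
  shows "beta_star A' \<le> beta_star A"
proof (rule beta_star_greatest)
  fix B C :: "int set"
  assume BC: "finite B" "B \<noteq> {}" "0 \<notin> B" "finite C" "C \<noteq> {}" "0 \<notin> C"
  have "A' * B * C \<subseteq> A * B * C" using assms(1) by (intro set_times_mono2) auto
  then have "card (A' * B * C) \<le> card (A * B * C)"
    using assms(2) BC by (intro card_mono finite_set_times) auto
  then show "beta_star A' * (sqrt (card B) * sqrt (card C)) \<le> card (A * B * C)"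
    using beta_star_mult_le[of B C A'] BC by linarith
qed

lemma beta_star_ge_1:
  assumes "finite A" "A \<noteq> {}" "0 \<notin> A"
  shows "1 \<le> beta_star A"
proof (rule beta_star_greatest)
  fix B C :: "int set"
  assume BC: "finite B" "B \<noteq> {}" "0 \<notin> B" "finite C" "C \<noteq> {}" "0 \<notin> C"
  obtain a b c where abc: "a \<in> A" "b \<in> B" "c \<in> C" using assms BC by auto
  have nz: "a * c \<noteq> 0" "a * b \<noteq> 0" using abc assms BC by auto
  have fin: "finite (A * B * C)" using assms BC by (intro finite_set_times)
  have "card B = card ((\<lambda>x. a * c * x) ` B)" "card C = card ((\<lambda>x. a * b * x) ` C)"
    using nz by (auto intro!: card_image[symmetric] inj_onI)
  moreover have "card ((\<lambda>x. a * c * x) ` B) \<le> card (A * B * C)"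
  proof (intro card_mono fin subsetI)
    fix z assume "z \<in> (\<lambda>x. a * c * x) ` B"
    then obtain x where "x \<in> B" "z = a * x * c" by (auto simp: mult_ac)
    then show "z \<in> A * B * C" using abc by (auto intro: set_times_intro)
  qed
  moreover have "card ((\<lambda>x. a * b * x) ` C) \<le> card (A * B * C)"
    using abc by (intro card_mono fin) (auto intro: set_times_intro)
  ultimately have le: "card B \<le> card (A * B * C)" "card C \<le> card (A * B * C)" by auto
  then have "sqrt (card B) * sqrt (card C) \<le> sqrt (card (A * B * C)) * sqrt (card (A * B * C))"
    by (intro mult_mono) auto
  then show "1 * (sqrt (card B) * sqrt (card C)) \<le> card (A * B * C)" by simp
qed

definition fibre :: "int \<Rightarrow> int set \<Rightarrow> nat \<Rightarrow> int set" where
  "fibre p A i = {a \<in> A. multiplicity p a = i}"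

lemma fibre_subset: "fibre p A i \<subseteq> A"
  by (auto simp: fibre_def)

text \<open>
  The key property of \<^const>\<open>beta_star\<close>. Split \<open>B\<close> and \<open>C\<close> into their own fibres. The fibre of \<open>A * B * C\<close>
  over \<open>i + s + t\<close> contains the product of the fibres over \<open>i\<close>, \<open>s\<close> and \<open>t\<close>, and likewise for \<open>j\<close>. So
  the fibre sizes of \<open>A * B * C\<close> satisfy the hypotheses of the weighted Prekopa-Leindler inequality for the
  functions \<open>sqrt (card B\<^sub>s)\<close> and \<open>sqrt (card C\<^sub>t)\<close>, whose \<open>\<ell>\<^sup>2\<close> norms are
  \<open>sqrt (card B)\<close> and \<open>sqrt (card C)\<close>.
\<close>
lemma beta_star_add_fibres:
  assumes A: "finite A" "0 \<notin> A" and p: "prime p" and ij: "i \<noteq> j"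
    and ne: "fibre p A i \<noteq> {}" "fibre p A j \<noteq> {}"
  shows "beta_star (fibre p A i) + beta_star (fibre p A j) \<le> beta_star A"
proof (rule beta_star_greatest)
  fix B C :: "int set"
  assume B: "finite B" "B \<noteq> {}" "0 \<notin> B" and C: "finite C" "C \<noteq> {}" "0 \<notin> C"
  define v where "v = (\<lambda>x. int (multiplicity p x))"
  define U where "U = A * B * C"
  have U: "finite U" unfolding U_def using A B C by (intro finite_set_times)
  define L where "L X s = {x\<in>X. v x = s}" for X s
  have L: "finite (L X s)" "0 \<notin> L X s" if "finite X" "0 \<notin> X" for X s using that by (auto simp: L_def)
  have v_mult: "v (x * y * z) = v x + v y + v z" if "x \<noteq> 0" "y \<noteq> 0" "z \<noteq> 0" for x y z
    using that prime_imp_prime_elem[OF p] by (simp add: v_def prime_elem_multiplicity_mult_distrib)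
  have card_L: "(\<Sum>s\<in>v ` X. real (card (L X s))) = card X" if "finite X" for X
    using sum.image_gen[OF that, of "\<lambda>_. 1::real" v] by (simp add: L_def)
  have sum_sq: "(\<Sum>s\<in>v ` X. (sqrt (card (L X s)))\<^sup>2) = card X" if "finite X" for X
    using card_L[OF that] by simp
  have fib: "int k + s + t \<in> v ` U \<and>
      beta_star (fibre p A k) * (sqrt (card (L B s)) * sqrt (card (L C t))) \<le> card (L U (int k + s + t))"
    if k: "fibre p A k \<noteq> {}" and s: "s \<in> v ` B" and t: "t \<in> v ` C" for k s t
  proof
    have sub: "fibre p A k * L B s * L C t \<subseteq> L U (int k + s + t)"
    proof
      fix z assume "z \<in> fibre p A k * L B s * L C t"
      then obtain a b c where "z = a * b * c" "a \<in> fibre p A k" "b \<in> L B s" "c \<in> L C t"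
        by (auto elim!: set_times_elim)
      moreover from this have "v (a * b * c) = v a + v b + v c"
        using A B C by (intro v_mult) (auto simp: fibre_def L_def)
      ultimately show "z \<in> L U (int k + s + t)"
        by (auto simp: L_def fibre_def v_def U_def intro!: set_times_intro)
    qed
    obtain a b c where abc: "a \<in> fibre p A k" "b \<in> L B s" "c \<in> L C t"
      using k s t by (auto simp: L_def)
    then have "a * b * c \<in> L U (int k + s + t)" using sub by (auto intro: set_times_intro)
    then show "int k + s + t \<in> v ` U" by (intro image_eqI[where x = "a * b * c"]) (auto simp: L_def)
    have "card (fibre p A k * L B s * L C t) \<le> card (L U (int k + s + t))"
      using sub U by (intro card_mono) (auto simp: L_def)
    then show "beta_star (fibre p A k) * (sqrt (card (L B s)) * sqrt (card (L C t)))
        \<le> card (L U (int k + s + t))"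
      using beta_star_mult_le[OF L[OF B(1,3)] L[OF C(1,3)], of "fibre p A k" s t] by linarith
  qed
  have pos: "0 < beta_star (fibre p A i)" "0 < beta_star (fibre p A j)"
    using beta_star_ge_1[of "fibre p A i"] beta_star_ge_1[of "fibre p A j"] A ne
    by (auto simp: fibre_def)
  have "(beta_star (fibre p A i) + beta_star (fibre p A j)) *
      (sqrt (\<Sum>s\<in>v ` B. (sqrt (card (L B s)))\<^sup>2) * sqrt (\<Sum>t\<in>v ` C. (sqrt (card (L C t)))\<^sup>2))
      \<le> (\<Sum>d\<in>v ` U. real (card (L U d)))"
    by (rule weighted_Prekopa_Leindler[where i = "int i" and j = "int j"])
      (use ij pos fib ne U B C in auto)
  then show "(beta_star (fibre p A i) + beta_star (fibre p A j)) * (sqrt (card B) * sqrt (card C))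
      \<le> card (A * B * C)"
    using card_L[OF U] sum_sq[OF B(1)] sum_sq[OF C(1)] by (simp add: U_def)
qed

section \<open>Moment bounds and large well-bounded subsets\<close>

text \<open>
  The least such \<open>L\<close> is \<^const>\<open>lam\<close>, up to allowing arbitrary real weights. The homogeneous form makes
  restriction to subsets trivial, since weights may vanish.
\<close>
definition moment_bound :: "nat \<Rightarrow> int set \<Rightarrow> real \<Rightarrow> bool" where
  "moment_bound k A L \<longleftrightarrow> (\<forall>c. moment k A c \<le> (L * (\<Sum>n\<in>A. (c n)\<^sup>2)) ^ k)"

lemma moment_bound_mono:
  assumes "moment_bound k A L" "0 \<le> L" "L \<le> L'"
  shows "moment_bound k A L'"
  unfolding moment_bound_def
proof
  fix c
  have "moment k A c \<le> (L * (\<Sum>n\<in>A. (c n)\<^sup>2)) ^ k" using assms by (simp add: moment_bound_def)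
  also have "\<dots> \<le> (L' * (\<Sum>n\<in>A. (c n)\<^sup>2)) ^ k"
    using assms by (intro power_mono mult_right_mono mult_nonneg_nonneg) (auto intro: sum_nonneg)
  finally show "moment k A c \<le> (L' * (\<Sum>n\<in>A. (c n)\<^sup>2)) ^ k" .
qed

lemma moment_bound_subset:
  assumes "moment_bound k A L" "A' \<subseteq> A" "finite A"
  shows "moment_bound k A' L"
  unfolding moment_bound_def
proof
  fix c
  define c' where "c' n = (if n \<in> A' then c n else (0 :: real))" for n
  have "trig_poly A c' x = trig_poly A' c x" for x
    unfolding trig_poly_def using assms(2,3)
    by (intro sum.mono_neutral_cong_right) (auto simp: c'_def)
  then have "moment k A c' = moment k A' c" by (simp add: moment_def)
  moreover have "(\<Sum>n\<in>A. (c' n)\<^sup>2) = (\<Sum>n\<in>A'. (c n)\<^sup>2)"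
    using assms(2,3) by (intro sum.mono_neutral_cong_right) (auto simp: c'_def)
  ultimately show "moment k A' c \<le> (L * (\<Sum>n\<in>A'. (c n)\<^sup>2)) ^ k"
    using assms(1) by (metis moment_bound_def)
qed

text \<open>
  Pointwise Cauchy-Schwarz.
\<close>
lemma moment_bound_card:
  assumes "finite A"
  shows "moment_bound k A (card A)"
  unfolding moment_bound_def
proof
  fix c
  have "norm (trig_poly A c x) ^ (2 * k) \<le> (real (card A) * (\<Sum>n\<in>A. (c n)\<^sup>2)) ^ k" for x
  proof -
    have "norm (trig_poly A c x) \<le> (\<Sum>n\<in>A. 1 * \<bar>c n\<bar>)"
      unfolding trig_poly_character by (rule order_trans[OF norm_sum]) (simp add: norm_mult)
    then have "(norm (trig_poly A c x))\<^sup>2 \<le> (\<Sum>n\<in>A. 1 * \<bar>c n\<bar>)\<^sup>2" by (intro power_mono) auto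
    also have "\<dots> \<le> (\<Sum>n\<in>A. 1\<^sup>2) * (\<Sum>n\<in>A. \<bar>c n\<bar>\<^sup>2)" by (rule Cauchy_Schwarz_ineq_sum)
    finally show ?thesis by (simp add: power_mult power_mono)
  qed
  then have "moment k A c \<le> integral {0..1} (\<lambda>x::real. (real (card A) * (\<Sum>n\<in>A. (c n)\<^sup>2)) ^ k)"
    unfolding moment_def by (intro integral_le integrable_continuous_real continuous_intros)
  then show "moment k A c \<le> (real (card A) * (\<Sum>n\<in>A. (c n)\<^sup>2)) ^ k" by simp
qed

text \<open>
  Peel off the fibre of least valuation \<open>j\<close>: all other elements are divisible by \<open>p\<close> to the power
  \<open>j + 1\<close>. By the separation inequality each fibre pays the factor \<open>k\<^sup>2\<close> once, at the moment it is
  peeled off, so the number of fibres does not matter.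
\<close>
lemma moment_bound_fibres:
  assumes "k \<ge> 1" "prime p" "0 \<le> L" "finite A" "0 \<notin> A"
    and "\<And>i. moment_bound k (fibre p A i) L"
  shows "moment_bound k A ((real k)\<^sup>2 * L)"
  using assms(4-6)
proof (induction A rule: finite_psubset_induct)
  case (psubset A)
  show ?case
  proof (cases "A = {}")
    case True
    then show ?thesis using assms(1) by (simp add: moment_bound_def moment_def trig_poly_def power_0_left)
  next
    case False
    define j where "j = Min (multiplicity p ` A)"
    have "j \<in> multiplicity p ` A" unfolding j_def using False psubset.hyps by (intro Min_in) auto
    then have ne: "fibre p A j \<noteq> {}" by (auto simp: fibre_def)
    have j: "j \<le> multiplicity p a" if "a \<in> A" for a using that psubset.hyps by (simp add: j_def)
    define R where "R = A - fibre p A j"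
    have A: "A = R \<union> fibre p A j" "R \<inter> fibre p A j = {}" "finite R" "finite (fibre p A j)"
      using psubset.hyps by (auto simp: R_def fibre_def)
    have "fibre p R i \<subseteq> fibre p A i" "finite (fibre p A i)" for i
      using psubset.hyps by (auto simp: R_def fibre_def)
    then have "moment_bound k (fibre p R i) L" for i
      using psubset.prems(2) moment_bound_subset by blast
    moreover have "R \<subset> A" using ne by (auto simp: R_def fibre_def)
    ultimately have R: "moment_bound k R ((real k)\<^sup>2 * L)"
      using psubset.IH[of R] psubset.prems(1) by (auto simp: R_def)
    have p: "p \<noteq> 0" "\<not> is_unit p" using assms(2) by auto
    show ?thesis
      unfolding moment_bound_def
    proof
      fix c
      have "moment k (R \<union> fibre p A j) c \<le> ((real k)\<^sup>2 * L * (\<Sum>n\<in>R. (c n)\<^sup>2)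
          + (real k)\<^sup>2 * (L * (\<Sum>n\<in>fibre p A j. (c n)\<^sup>2))) ^ k"
      proof (rule moment_Un_le_of_dvd[where P = "p ^ Suc j"])
        fix a assume "a \<in> R"
        then have "a \<in> A" "Suc j \<le> multiplicity p a"
          using j[of a] by (auto simp: R_def fibre_def)
        then show "p ^ Suc j dvd a" by (intro multiplicity_dvd')
      next
        fix b assume "b \<in> fibre p A j"
        then have "b \<noteq> 0" "multiplicity p b = j" using psubset.prems(1) by (auto simp: fibre_def)
        then show "\<not> p ^ Suc j dvd b" using p power_dvd_iff_le_multiplicity[of b p "Suc j"] by auto
      qed (use A assms psubset.prems(2) R in \<open>auto simp: moment_bound_def intro!: mult_nonneg_nonneg sum_nonneg\<close>)
      also have "\<dots> = ((real k)\<^sup>2 * L * (\<Sum>n\<in>R \<union> fibre p A j. (c n)\<^sup>2)) ^ k"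
        by (simp only: sum.union_disjoint[OF A(3,4,2)] distrib_left mult.assoc)
      finally show "moment k A c \<le> ((real k)\<^sup>2 * L * (\<Sum>n\<in>A. (c n)\<^sup>2)) ^ k"
        using A(1) by simp
    qed
  qed
qed

lemma moment_bound_singleton:
  shows "moment_bound k {a} 1"
  using moment_bound_card[of "{a}" k] by simp

text \<open>
  The signs are invisible to the valuations; they cost the factor 2 in the next lemma.
\<close>
lemma abs_eq_if_multiplicities_eq:
  fixes a b :: int
  assumes "a \<noteq> 0" "b \<noteq> 0" "\<And>p. prime p \<Longrightarrow> multiplicity p a = multiplicity p b"
  shows "\<bar>a\<bar> = \<bar>b\<bar>"
  using multiplicity_eq_imp_eq[of a b] assms by (simp add: normalize_int_def)

text \<open>
  Induction on the primes that distinguish elements of \<open>A\<close>. Split \<open>A\<close> into its fibres at \<open>p\<close>, let \<open>m\<close> be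
  the fibre with the largest constant \<open>\<beta>\<^sub>m\<close>, and write \<open>\<beta>\<close> for the constant of \<open>A\<close>. Every other fibre
  has \<open>\<beta>\<^sub>i \<le> \<beta> - \<beta>\<^sub>m\<close>, and then also \<open>\<beta>\<^sub>i \<le> \<beta> / 2\<close>, so the binary logarithm of the constant drops by at least one on
  all fibres but the largest. Two subsets are available: the one found inside
  fibre \<open>m\<close>, which captures the share \<open>1 / (2 \<beta>\<^sub>m)\<close> of the weight there, and the union of those found inside all other
  fibres, which captures the share \<open>1 / (2 (\<beta> - \<beta>\<^sub>m))\<close> of the remaining weight and pays the factor \<open>k\<^sup>2\<close>
  for joining fibres out of the gained unit of the logarithm. One of the two shares amounts to \<open>1 / (2 \<beta>)\<close> of the
  total weight, since \<open>\<beta>\<close> is the sum of \<open>\<beta>\<^sub>m\<close> and \<open>\<beta> - \<beta>\<^sub>m\<close>.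
\<close>
lemma exists_large_moment_bounded_subset:
  fixes w :: "int \<Rightarrow> real"
  assumes "finite P" "\<And>p. p \<in> P \<Longrightarrow> prime p" "k \<ge> 1" "finite A" "A \<noteq> {}" "0 \<notin> A"
    and "\<And>a b p. a \<in> A \<Longrightarrow> b \<in> A \<Longrightarrow> prime p \<Longrightarrow> p \<notin> P \<Longrightarrow> multiplicity p a = multiplicity p b"
    and "\<And>n. 0 \<le> w n"
  shows "\<exists>A'\<subseteq>A. (\<Sum>n\<in>A. w n) \<le> 2 * beta_star A * (\<Sum>n\<in>A'. w n)
    \<and> moment_bound k A' ((real k)\<^sup>2 powr log 2 (beta_star A))"
  using assms
proof (induction P arbitrary: A rule: finite_induct)
  case empty
  have \<beta>: "1 \<le> beta_star A" using beta_star_ge_1 empty.prems(2-5,7) by blast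
  have "Max (w ` A) \<in> w ` A" using empty.prems(2-5,7) by (intro Max_in) auto
  then obtain x where x: "x \<in> A" "w x = Max (w ` A)" by auto
  then have max: "w a \<le> w x" if "a \<in> A" for a using that empty.prems(2-5,7) by simp
  have "A \<subseteq> {x, - x}"
  proof
    fix a assume a: "a \<in> A"
    have "\<bar>a\<bar> = \<bar>x\<bar>"
    proof (rule abs_eq_if_multiplicities_eq)
      show "a \<noteq> 0" "x \<noteq> 0" using a x(1) empty.prems(5) by auto
      show "multiplicity p a = multiplicity p x" if "prime p" for p
        using that by (intro empty.prems(6) a x(1)) auto
    qed
    then show "a \<in> {x, - x}" by (auto simp: abs_eq_iff)
  qed
  then have "card A \<le> card {x, - x}" by (intro card_mono) auto
  also have "\<dots> \<le> 2" by (simp add: card_insert_if)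
  finally have "card A \<le> 2" .
  have "(\<Sum>n\<in>A. w n) \<le> real (card A) * w x" using max by (rule sum_bounded_above)
  also have "\<dots> \<le> 2 * w x" using \<open>card A \<le> 2\<close> empty.prems(2-5,7) by (intro mult_right_mono) auto
  also have "\<dots> \<le> 2 * beta_star A * w x" using \<beta> empty.prems(2-5,7) by (intro mult_right_mono) auto
  finally have "(\<Sum>n\<in>A. w n) \<le> 2 * beta_star A * (\<Sum>n\<in>{x}. w n)" by simp
  moreover have "moment_bound k {x} ((real k)\<^sup>2 powr log 2 (beta_star A))"
    using \<beta> empty.prems(2-5,7) by (intro moment_bound_mono[OF moment_bound_singleton] ge_one_powr_ge_zero) auto
  ultimately show ?case using x by blast
next
  case (insert p P)
  define \<beta> where "\<beta> i = beta_star (fibre p A i)" for i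
  define W where "W i = (\<Sum>n\<in>fibre p A i. w n)" for i
  define J where "J = multiplicity p ` A"
  have p: "prime p" using insert.prems(1-5,7) by auto
  have J: "finite J" "J \<noteq> {}" using insert.prems(1-5,7) by (auto simp: J_def)
  have fib: "fibre p A i \<noteq> {}" "finite (fibre p A i)" "0 \<notin> fibre p A i" if "i \<in> J" for i
    using that insert.prems(1-5,7) by (auto simp: J_def fibre_def)
  have \<beta>: "1 \<le> \<beta> i" if "i \<in> J" for i using beta_star_ge_1 fib[OF that] by (simp add: \<beta>_def)
  have \<beta>_le: "\<beta> i \<le> beta_star A" for i
    unfolding \<beta>_def using insert.prems(1-5,7) fibre_subset by (intro beta_star_mono)
  have \<beta>_add: "\<beta> i + \<beta> j \<le> beta_star A" if "i \<in> J" "j \<in> J" "i \<noteq> j" for i j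
    unfolding \<beta>_def using that fib p insert.prems(1-5,7) by (intro beta_star_add_fibres) auto
  have W0: "0 \<le> W i" for i unfolding W_def using insert.prems(1-5,7) by (intro sum_nonneg)
  have sumW: "(\<Sum>i\<in>J. W i) = (\<Sum>n\<in>A. w n)"
    using sum.image_gen[OF insert.prems(3), of w "multiplicity p"] by (simp add: J_def W_def fibre_def)
  have "\<exists>A'\<subseteq>fibre p A i. W i \<le> 2 * \<beta> i * (\<Sum>n\<in>A'. w n)
      \<and> moment_bound k A' ((real k)\<^sup>2 powr log 2 (\<beta> i))" if i: "i \<in> J" for i
    unfolding W_def \<beta>_def
  proof (rule insert.IH)
    fix a b q assume "a \<in> fibre p A i" "b \<in> fibre p A i" "prime q" "q \<notin> P"
    then show "multiplicity q a = multiplicity q b"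
      using insert.prems(6)[of a b q] by (cases "q = p") (auto simp: fibre_def)
  qed (use fib[OF i] insert.prems(1-5,7) in auto)
  then obtain F where F: "F i \<subseteq> fibre p A i" "W i \<le> 2 * \<beta> i * (\<Sum>n\<in>F i. w n)"
    "moment_bound k (F i) ((real k)\<^sup>2 powr log 2 (\<beta> i))" if "i \<in> J" for i
    by metis
  have F_fibre: "x \<in> A \<and> multiplicity p x = i" if "i \<in> J" "x \<in> F i" for i x
    using F(1)[OF that(1)] that(2) by (auto simp: fibre_def)
  have powr_mono_k: "(real k)\<^sup>2 powr x \<le> (real k)\<^sup>2 powr y" if "x \<le> y" for x y
    using that insert.prems(2) by (intro powr_mono) auto
  have "Max (\<beta> ` J) \<in> \<beta> ` J" using J by (intro Max_in) auto
  then obtain m where m: "m \<in> J" "\<beta> m = Max (\<beta> ` J)" by auto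
  then have max: "\<beta> i \<le> \<beta> m" if "i \<in> J" for i using that J by simp
  show ?case
  proof (cases "(\<Sum>i\<in>J. W i) * \<beta> m \<le> W m * beta_star A")
    case True
    have "(\<Sum>i\<in>J. W i) * \<beta> m \<le> W m * beta_star A" by (rule True)
    also have "\<dots> \<le> (2 * \<beta> m * (\<Sum>n\<in>F m. w n)) * beta_star A"
      using F(2)[OF m(1)] \<beta>[OF m(1)] \<beta>_le[of m] by (intro mult_right_mono) auto
    also have "\<dots> = (2 * beta_star A * (\<Sum>n\<in>F m. w n)) * \<beta> m" by simp
    finally have "(\<Sum>n\<in>A. w n) \<le> 2 * beta_star A * (\<Sum>n\<in>F m. w n)"
      using \<beta>[OF m(1)] unfolding sumW by simp
    moreover have "moment_bound k (F m) ((real k)\<^sup>2 powr log 2 (beta_star A))"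
      using \<beta>[OF m(1)] \<beta>_le[of m]
      by (intro moment_bound_mono[OF F(3)[OF m(1)]] powr_mono_k) auto
    ultimately show ?thesis using F(1)[OF m(1)] fibre_subset by blast
  next
    case False
    define J' where "J' = J - {m}"
    define A' where "A' = (\<Union>i\<in>J'. F i)"
    have J': "i \<in> J" "i \<noteq> m" if "i \<in> J'" for i using that by (auto simp: J'_def)
    have A'_D: "x \<in> A \<and> multiplicity p x \<in> J' \<and> x \<in> F (multiplicity p x)" if "x \<in> A'" for x
    proof -
      obtain i where i: "i \<in> J'" "x \<in> F i" using \<open>x \<in> A'\<close> by (auto simp: A'_def)
      with F_fibre[OF J'(1)[OF i(1)] i(2)] show ?thesis by simp
    qed
    then have sub: "A' \<subseteq> A" by blast
    have "finite J'" using J by (simp add: J'_def)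
    have sumA': "(\<Sum>n\<in>A'. w n) = (\<Sum>i\<in>J'. \<Sum>n\<in>F i. w n)"
      unfolding A'_def
    proof (rule sum.UNION_disjoint)
      show "\<forall>i\<in>J'. finite (F i)" using F(1) fib(2) J' by (meson finite_subset)
      show "\<forall>i\<in>J'. \<forall>j\<in>J'. i \<noteq> j \<longrightarrow> F i \<inter> F j = {}"
        using F_fibre J' by (metis disjoint_iff)
    qed fact
    have WJ: "(\<Sum>i\<in>J. W i) = W m + (\<Sum>i\<in>J'. W i)"
      unfolding J'_def using J m by (intro sum.remove) auto
    \<comment> \<open>If fibre \<open>m\<close> were all of \<open>A\<close>, the first case would have applied.\<close>
    have "J' \<noteq> {}"
    proof
      assume "J' = {}"
      then have "J = {m}" using m by (auto simp: J'_def)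
      then have "fibre p A m = A" by (auto simp: J_def fibre_def)
      then show False using False \<open>J = {m}\<close> by (simp add: \<beta>_def)
    qed
    then obtain j where "j \<in> J'" by blast
    then have gap: "1 \<le> beta_star A - \<beta> m"
      using \<beta>_add[of j m] \<beta>[of j] m J' by fastforce
    have "(\<Sum>i\<in>J'. W i) \<le> (\<Sum>i\<in>J'. 2 * (beta_star A - \<beta> m) * (\<Sum>n\<in>F i. w n))"
    proof (rule sum_mono)
      fix i assume i: "i \<in> J'"
      have "W i \<le> 2 * \<beta> i * (\<Sum>n\<in>F i. w n)" using F J'[OF i] by blast
      also have "\<dots> \<le> 2 * (beta_star A - \<beta> m) * (\<Sum>n\<in>F i. w n)"
        using \<beta>_add[of i m] J'[OF i] m insert.prems(7)
        by (intro mult_right_mono) (auto intro: sum_nonneg)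
      finally show "W i \<le> 2 * (beta_star A - \<beta> m) * (\<Sum>n\<in>F i. w n)" .
    qed
    also have "\<dots> = 2 * (beta_star A - \<beta> m) * (\<Sum>n\<in>A'. w n)"
      by (simp add: sumA' sum_distrib_left)
    finally have W': "(\<Sum>i\<in>J'. W i) \<le> 2 * (beta_star A - \<beta> m) * (\<Sum>n\<in>A'. w n)" .
    have "(\<Sum>i\<in>J. W i) * (beta_star A - \<beta> m) \<le> (\<Sum>i\<in>J'. W i) * beta_star A"
      using False by (simp add: WJ algebra_simps)
    also have "\<dots> \<le> (2 * (beta_star A - \<beta> m) * (\<Sum>n\<in>A'. w n)) * beta_star A"
      using W' \<beta>[OF m(1)] \<beta>_le[of m] by (intro mult_right_mono) auto
    also have "\<dots> = (2 * beta_star A * (\<Sum>n\<in>A'. w n)) * (beta_star A - \<beta> m)" by simp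
    finally have "(\<Sum>n\<in>A. w n) \<le> 2 * beta_star A * (\<Sum>n\<in>A'. w n)"
      using gap unfolding sumW by simp
    moreover have "moment_bound k A' ((real k)\<^sup>2 powr log 2 (beta_star A))"
    proof -
      \<comment> \<open>\<open>L\<close> is the bound on the fibres; joining them multiplies it by \<open>k\<^sup>2\<close>.\<close>
      define L where "L = (real k)\<^sup>2 powr (log 2 (beta_star A) - 1)"
      have "moment_bound k A' ((real k)\<^sup>2 * L)"
      proof (rule moment_bound_fibres[OF insert.prems(2) p])
        show "finite A'" "0 \<notin> A'" using sub insert.prems(1-5,7) by (auto intro: finite_subset)
        fix i
        show "moment_bound k (fibre p A' i) L"
        proof (cases "i \<in> J'")
          case True
          have "2 * \<beta> i \<le> beta_star A"
            using \<beta>_add[of i m] max[of i] J'[OF True] m by auto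
          then have "log 2 (2 * \<beta> i) \<le> log 2 (beta_star A)"
            using \<beta>[OF J'(1)[OF True]] by (intro log_mono) auto
          then have "log 2 (\<beta> i) \<le> log 2 (beta_star A) - 1"
            using \<beta>[OF J'(1)[OF True]] by (simp add: log_mult)
          then have "moment_bound k (F i) L"
            unfolding L_def
            by (intro moment_bound_mono[OF F(3)[OF J'(1)[OF True]]] powr_mono_k) auto
          moreover have "fibre p A' i \<subseteq> F i" using A'_D by (auto simp: fibre_def)
          moreover have "finite (F i)" using F(1) fib(2) J'(1)[OF True] by (meson finite_subset)
          ultimately show ?thesis using moment_bound_subset by blast
        next
          case False
          then have "fibre p A' i = {}" using A'_D by (auto simp: fibre_def)
          then show ?thesis using moment_bound_card[of "{}" k]
            by (auto intro: moment_bound_mono simp: L_def)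
        qed
      qed (simp add: L_def)
      also have "(real k)\<^sup>2 * L = (real k)\<^sup>2 powr log 2 (beta_star A)"
        using insert.prems(2) by (simp add: L_def powr_diff)
      finally show ?thesis .
    qed
    ultimately show ?thesis using sub by blast
  qed
qed

text \<open>
  Split the polynomial into its part on \<open>A'\<close>, which carries a share \<open>\<mu> \<ge> 1 / M\<close> of the weight, and the rest,
  to which the assumed bound \<open>t\<close> applies. The triangle inequality gives
  \<open>sqrt (\<mu> \<Lambda>) + t sqrt (1 - \<mu>)\<close>. With \<open>s\<^sup>2 = 4 M \<Lambda>\<close> the first summand is at most \<open>\<mu> s / 2\<close>, and the second
  is at most \<open>t (1 - \<mu> / 2)\<close>: the bound moves from \<open>t\<close> towards \<open>s\<close> by the fraction \<open>\<mu> / 2\<close> of the distance.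
\<close>
lemma moment_bound_bootstrap_step:
  assumes fin: "finite A" and M: "M \<ge> 1" and s: "0 \<le> s" "s \<le> t" and \<Lambda>: "0 \<le> \<Lambda>" "s\<^sup>2 = 4 * M * \<Lambda>"
    and sub: "\<And>c. \<exists>A'\<subseteq>A. (\<Sum>n\<in>A. (c n)\<^sup>2) \<le> M * (\<Sum>n\<in>A'. (c n)\<^sup>2) \<and> moment_bound k A' \<Lambda>"
    and t: "moment_bound k A (t\<^sup>2)"
  shows "moment_bound k A ((t - (t - s) / (2 * M))\<^sup>2)"
  unfolding moment_bound_def
proof
  fix c :: "int \<Rightarrow> real"
  define \<tau> where "\<tau> = t - (t - s) / (2 * M)"
  obtain A' where A': "A' \<subseteq> A" "(\<Sum>n\<in>A. (c n)\<^sup>2) \<le> M * (\<Sum>n\<in>A'. (c n)\<^sup>2)" "moment_bound k A' \<Lambda>"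
    using sub[of c] by blast
  define S m where "S = (\<Sum>n\<in>A. (c n)\<^sup>2)" and "m = (\<Sum>n\<in>A'. (c n)\<^sup>2)"
  define R where "R = A - A'"
  have R: "A = A' \<union> R" "A' \<inter> R = {}" "finite A'" "finite R"
    using A'(1) fin by (auto simp: R_def intro: finite_subset)
  have "(\<Sum>n\<in>A' \<union> R. (c n)\<^sup>2) = m + (\<Sum>n\<in>R. (c n)\<^sup>2)"
    unfolding m_def using R by (intro sum.union_disjoint) auto
  then have sumR: "(\<Sum>n\<in>R. (c n)\<^sup>2) = S - m" using R(1) by (simp add: S_def)
  have m: "0 \<le> m" "m \<le> S" "S \<le> M * m"
    using A'(2) sumR sum_nonneg[of R "\<lambda>n. (c n)\<^sup>2"] by (auto simp: S_def m_def intro: sum_nonneg)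
  have "moment k (A' \<union> R) c \<le> (sqrt (\<Lambda> * m) + t * sqrt (S - m)) ^ (2 * k)"
  proof (rule moment_Un_le)
    have "moment k A' c \<le> (\<Lambda> * m) ^ k" using A'(3) by (simp add: moment_bound_def m_def)
    also have "\<dots> = sqrt (\<Lambda> * m) ^ (2 * k)" using \<Lambda> m by (simp add: power_mult)
    finally show "moment k A' c \<le> sqrt (\<Lambda> * m) ^ (2 * k)" .
    have "moment_bound k R (t\<^sup>2)" using moment_bound_subset[OF t _ fin] R by blast
    then have "moment k R c \<le> (t\<^sup>2 * (S - m)) ^ k" unfolding sumR[symmetric] by (simp add: moment_bound_def)
    also have "\<dots> = (t * sqrt (S - m)) ^ (2 * k)" using m by (simp add: power_mult power_mult_distrib)
    finally show "moment k R c \<le> (t * sqrt (S - m)) ^ (2 * k)" .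
  qed (use R s \<Lambda> m in auto)
  also have "\<dots> \<le> (\<tau> * sqrt S) ^ (2 * k)"
  proof (cases "S = 0")
    case True
    then show ?thesis using m by simp
  next
    case False
    then have S: "0 < S" using m by simp
    define \<mu> where "\<mu> = m / S"
    have \<mu>: "0 \<le> \<mu>" "\<mu> \<le> 1" "1 / M \<le> \<mu>" "m = \<mu> * S"
      using m S M by (auto simp: \<mu>_def field_simps)
    have "sqrt (\<Lambda> * m) \<le> \<mu> / 2 * s * sqrt S"
    proof (rule real_le_lsqrt)
      have "1 \<le> M * \<mu>" using \<mu>(3) M by (simp add: field_simps)
      then have "\<Lambda> * (\<mu> * S) * 1 \<le> \<Lambda> * (\<mu> * S) * (M * \<mu>)"
        using \<Lambda> \<mu> S by (intro mult_left_mono) auto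
      also have "\<dots> = (\<mu> / 2)\<^sup>2 * s\<^sup>2 * S" using \<Lambda>(2) by (simp add: power2_eq_square)
      also have "\<dots> = (\<mu> / 2 * s * sqrt S)\<^sup>2" using S by (simp add: power_mult_distrib power_divide)
      finally show "\<Lambda> * m \<le> (\<mu> / 2 * s * sqrt S)\<^sup>2" using \<mu>(4) by simp
    qed (use \<mu> s S in auto)
    moreover have "t * sqrt (S - m) \<le> t * ((1 - \<mu> / 2) * sqrt S)"
    proof (intro mult_left_mono real_le_lsqrt)
      have "S - m = (1 - \<mu>) * S" using \<mu>(4) by (simp add: algebra_simps)
      also have "\<dots> \<le> (1 - \<mu> / 2)\<^sup>2 * S"
        using S by (intro mult_right_mono) (auto simp: power2_eq_square algebra_simps)
      also have "\<dots> = ((1 - \<mu> / 2) * sqrt S)\<^sup>2" using S by (simp add: power_mult_distrib)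
      finally show "S - m \<le> ((1 - \<mu> / 2) * sqrt S)\<^sup>2" .
    qed (use \<mu> s S in auto)
    moreover have "\<mu> / 2 * s * sqrt S + t * ((1 - \<mu> / 2) * sqrt S) \<le> \<tau> * sqrt S"
    proof -
      have "(1 / M) * ((t - s) / 2) \<le> \<mu> * ((t - s) / 2)" using \<mu> s by (intro mult_right_mono) auto
      then have "\<mu> / 2 * s + t * (1 - \<mu> / 2) \<le> \<tau>" by (simp add: \<tau>_def algebra_simps)
      then have "(\<mu> / 2 * s + t * (1 - \<mu> / 2)) * sqrt S \<le> \<tau> * sqrt S"
        using S by (intro mult_right_mono) auto
      then show ?thesis by (simp add: algebra_simps)
    qed
    ultimately have "sqrt (\<Lambda> * m) + t * sqrt (S - m) \<le> \<tau> * sqrt S" by linarith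
    then show ?thesis using s \<Lambda> m by (intro power_mono) auto
  qed
  also have "\<dots> = (\<tau>\<^sup>2 * S) ^ k" using m by (simp add: power_mult power_mult_distrib)
  finally show "moment k A c \<le> ((t - (t - s) / (2 * M))\<^sup>2 * (\<Sum>n\<in>A. (c n)\<^sup>2)) ^ k"
    using R(1) by (simp add: \<tau>_def S_def)
qed

text \<open>
  Passing from large subsets to the whole set loses only the constant factor \<open>4 M\<close> and no logarithm:
  iterating the preceding step from the trivial bound converges geometrically to \<open>s\<close>.
\<close>
lemma moment_bound_bootstrap:
  assumes fin: "finite A" and M: "M \<ge> 1" and \<Lambda>: "0 \<le> \<Lambda>"
    and sub: "\<And>c. \<exists>A'\<subseteq>A. (\<Sum>n\<in>A. (c n)\<^sup>2) \<le> M * (\<Sum>n\<in>A'. (c n)\<^sup>2) \<and> moment_bound k A' \<Lambda>"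
  shows "moment_bound k A (4 * M * \<Lambda>)"
proof -
  define s where "s = sqrt (4 * M * \<Lambda>)"
  have s: "0 \<le> s" "s\<^sup>2 = 4 * M * \<Lambda>" using M \<Lambda> by (auto simp: s_def)
  define r where "r = 1 - 1 / (2 * M)"
  have r: "0 \<le> r" "r < 1" using M by (auto simp: r_def field_simps)
  define N where "N = sqrt (card A)"
  define t where "t i = s + N * r ^ i" for i
  have bd: "moment_bound k A ((t i)\<^sup>2)" for i
  proof (induction i)
    case 0
    have "N\<^sup>2 \<le> (s + N)\<^sup>2" using s by (intro power_mono) (auto simp: N_def)
    then show ?case
      using moment_bound_mono[OF moment_bound_card[OF fin]] by (simp add: t_def N_def)
  next
    case (Suc i)
    have "s \<le> t i" using r by (simp add: t_def N_def)
    then have "moment_bound k A ((t i - (t i - s) / (2 * M))\<^sup>2)"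
      using Suc.IH s \<Lambda> by (intro moment_bound_bootstrap_step[OF fin M _ _ _ _ sub]) auto
    moreover have "t i - (t i - s) / (2 * M) = t (Suc i)"
      by (simp add: t_def r_def algebra_simps)
    ultimately show ?case by simp
  qed
  have "t \<longlonglongrightarrow> s + N * 0"
    unfolding t_def using r by (intro tendsto_intros LIMSEQ_realpow_zero)
  then have lim: "t \<longlonglongrightarrow> s" by simp
  show ?thesis
    unfolding moment_bound_def
  proof
    fix c
    have "(\<lambda>i. ((t i)\<^sup>2 * (\<Sum>n\<in>A. (c n)\<^sup>2)) ^ k) \<longlonglongrightarrow> (s\<^sup>2 * (\<Sum>n\<in>A. (c n)\<^sup>2)) ^ k"
      by (intro tendsto_intros lim)
    then show "moment k A c \<le> (4 * M * \<Lambda> * (\<Sum>n\<in>A. (c n)\<^sup>2)) ^ k"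
      using bd s(2) by (intro LIMSEQ_le_const[where X = "\<lambda>i. ((t i)\<^sup>2 * (\<Sum>n\<in>A. (c n)\<^sup>2)) ^ k"])
        (auto simp: moment_bound_def)
  qed
qed

section \<open>The bound\<close>

lemma Lp_norm01_trig_poly:
  assumes "k \<ge> 1"
  shows "Lp_norm01 (2 * real k) (trig_poly A c) = moment k A c powr (1 / (2 * real k))"
proof -
  have "norm (trig_poly A c x) powr (2 * real k) = norm (trig_poly A c x) ^ (2 * k)" for x
    using powr_realpow'[of "norm (trig_poly A c x)" "2 * k"] assms by simp
  moreover have "(LBINT x:{0..1}. norm (trig_poly A c x) ^ (2 * k)) = moment k A c"
    unfolding moment_def
    by (intro set_borel_integral_eq_integral(2) borel_integrable_atLeastAtMost' continuous_intros)
  ultimately show ?thesis by (simp add: Lp_norm01_def)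
qed

lemma lam_le_of_moment_bound:
  assumes "k \<ge> 1" "finite A" "A \<noteq> {}" "0 \<le> L" "moment_bound k A L"
  shows "lam k A \<le> L"
  unfolding lam_def
proof (rule cSUP_least)
  have "\<exists>c :: int \<Rightarrow> real. (\<forall>n\<in>A. 0 < c n) \<and> (\<Sum>n\<in>A. (c n)\<^sup>2) = 1"
    using assms(2,3) by (intro exI[of _ "\<lambda>_. 1 / sqrt (card A)"]) (simp add: card_gt_0_iff power_divide)
  then show "{c :: int \<Rightarrow> real. (\<forall>n\<in>A. 0 < c n) \<and> (\<Sum>n\<in>A. (c n)\<^sup>2) = 1} \<noteq> {}"
    by (simp only: Collect_empty_eq not_all not_not simp_thms)
next
  fix c :: "int \<Rightarrow> real" assume c: "c \<in> {c. (\<forall>n\<in>A. 0 < c n) \<and> (\<Sum>n\<in>A. (c n)\<^sup>2) = 1}"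
  have m0: "0 \<le> moment k A c" unfolding moment_def by (intro integral_nonneg integrable_continuous_real continuous_intros) auto
  have "moment k A c \<le> (L * (\<Sum>n\<in>A. (c n)\<^sup>2)) ^ k" using assms(5) by (simp add: moment_bound_def)
  then have m: "moment k A c \<le> L ^ k" using c by simp
  have "(Lp_norm01 (2 * real k) (trig_poly A c))\<^sup>2 = moment k A c powr (1 / real k)"
    unfolding Lp_norm01_trig_poly[OF assms(1)] power2_eq_square powr_add[symmetric] by simp
  also have "\<dots> \<le> (L ^ k) powr (1 / real k)" using m0 m by (intro powr_mono2) auto
  also have "\<dots> = L"
    using assms(1,4) by (simp add: powr_realpow'[symmetric] powr_powr)
  finally show "(Lp_norm01 (2 * real k) (trig_poly A c))\<^sup>2 \<le> L" .
qed

theorem theorem1p3: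
  fixes \<epsilon> :: real and k :: nat and A :: "int set"
  assumes "0 < \<epsilon>" and "\<epsilon> < 1"
    and "k \<ge> 1"
    and "finite A" and "A \<noteq> {}" and "0 \<notin> A"
  shows "lam k A \<le> 10 * beta_star A powr (1 / \<epsilon>) * real (card A) powr (2 * \<epsilon> * log 2 (real k))"
proof -
  define \<beta> n where "\<beta> = beta_star A" and "n = real (card A)"
  have \<beta>: "1 \<le> \<beta>" unfolding \<beta>_def using assms by (intro beta_star_ge_1)
  have n: "1 \<le> n" using assms by (simp add: n_def Suc_le_eq card_gt_0_iff)
  have k: "0 \<le> log 2 (real k)" using assms by simp
  have inv: "1 \<le> 1 / \<epsilon>" using assms by simp
  have n_powr: "1 \<le> n powr (2 * \<epsilon> * log 2 (real k))"
    using n k assms by (intro ge_one_powr_ge_zero) auto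
  show ?thesis
  proof (cases "\<beta> \<le> n powr \<epsilon>")
    case True
    define \<Lambda> where "\<Lambda> = (real k)\<^sup>2 powr log 2 \<beta>"
    \<comment> \<open>Elements of \<open>A\<close> can only be distinguished by primes dividing one of them.\<close>
    define P where "P = (\<Union>a\<in>A. prime_factors a)"
    have "moment_bound k A (4 * (2 * \<beta>) * \<Lambda>)"
    proof (rule moment_bound_bootstrap)
      fix c :: "int \<Rightarrow> real"
      show "\<exists>A'\<subseteq>A. (\<Sum>n\<in>A. (c n)\<^sup>2) \<le> 2 * \<beta> * (\<Sum>n\<in>A'. (c n)\<^sup>2) \<and> moment_bound k A' \<Lambda>"
        unfolding \<beta>_def \<Lambda>_def
      proof (rule exists_large_moment_bounded_subset)
        show "finite P" "\<And>p. p \<in> P \<Longrightarrow> prime p" using assms by (auto simp: P_def)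
        fix a b p :: int assume ab: "a \<in> A" "b \<in> A" "prime p" "p \<notin> P"
        have "multiplicity p x = 0" if "x \<in> A" for x
          using that ab(3,4) assms(6) by (auto simp: P_def in_prime_factors_iff intro: not_dvd_imp_multiplicity_0)
        then show "multiplicity p a = multiplicity p b" using ab by simp
      qed (use assms in auto)
    qed (use assms \<beta> in \<open>auto simp: \<Lambda>_def\<close>)
    then have "lam k A \<le> 4 * (2 * \<beta>) * \<Lambda>"
      using assms \<beta> by (intro lam_le_of_moment_bound) (auto simp: \<Lambda>_def)
    moreover have "\<Lambda> \<le> n powr (2 * \<epsilon> * log 2 (real k))"
    proof -
      have "log 2 \<beta> \<le> log 2 (n powr \<epsilon>)" using True \<beta> by (intro log_mono) auto
      then have "log 2 \<beta> \<le> \<epsilon> * log 2 n" using n by (simp add: log_powr)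
      then have "\<Lambda> \<le> (real k)\<^sup>2 powr (\<epsilon> * log 2 n)"
        unfolding \<Lambda>_def using assms by (intro powr_mono) auto
      also have "\<dots> = n powr (2 * \<epsilon> * log 2 (real k))"
        using n assms by (simp add: powr_def log_def ln_realpow)
      finally show ?thesis .
    qed
    moreover have "\<beta> \<le> \<beta> powr (1 / \<epsilon>)" using powr_mono[OF inv \<beta>] \<beta> by simp
    ultimately have "lam k A \<le> 4 * (2 * \<beta> powr (1 / \<epsilon>)) * n powr (2 * \<epsilon> * log 2 (real k))"
      using \<beta> by (smt (verit) mult_mono powr_ge_zero zero_le_mult_iff)
    moreover have "0 \<le> \<beta> powr (1 / \<epsilon>) * n powr (2 * \<epsilon> * log 2 (real k))" by simp
    ultimately show ?thesis unfolding \<beta>_def n_def by linarith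
  next
    case False
    \<comment> \<open>Here \<open>|A| < \<beta> powr (1 / \<epsilon>)\<close>, and the trivial bound suffices.\<close>
    have "lam k A \<le> n"
      unfolding n_def using assms by (intro lam_le_of_moment_bound moment_bound_card) auto
    also have "n = (n powr \<epsilon>) powr (1 / \<epsilon>)" using n assms by (simp add: powr_powr)
    also have "\<dots> \<le> \<beta> powr (1 / \<epsilon>)" using False assms by (intro powr_mono2) auto
    also have "\<dots> \<le> 10 * \<beta> powr (1 / \<epsilon>)" by simp
    also have "\<dots> \<le> 10 * \<beta> powr (1 / \<epsilon>) * n powr (2 * \<epsilon> * log 2 (real k))"
      using mult_left_mono[OF n_powr, of "10 * \<beta> powr (1 / \<epsilon>)"] by simp
    finally show ?thesis by (simp add: \<beta>_def n_def)
  qed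
qed

end
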